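(* Let $p$ be a prime, $m\in\{0,1,2,\dots\}\cup\{\infty\}$, $s\in\mathbb{C}$ with $0<|s|<1$, $a\in\mathbb{C}\setminus\{0\}$, and $\alpha=1/D_s$. Endow $\mathbb{R}\times\mathbb{Z}_p$, $T_p$, $\mathbb{R}\times\mathbb{C}$, $S_1\times\mathbb{C}$ with the metrics $\hat\rho_\alpha,\rho_\alpha,\hat d,d$, respectively, and $\mathbb{R}^3$ with the standard Euclidean metric. Then: 1) ${}_\otimes\omega^{(m)}_s$ is an L-contraction, and therefore $\mho^{(m)}_s$ and $\Omega^{(m)}_{s,a}$ are also L-contractions; 2) if $\tilde\Delta^{(m)}_s>0$, then ${}_\otimes\omega^{(m)}_s$ and $\mho^{(m)}_s$ are L-isometries; if in addition $\gamma^{(m)}_{s,a}<1$, then $\Omega^{(m)}_{s,a}$ is an L-isometry.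
   Context: For $x\in\mathbb{Z}_p$, $x=\sum_{n\ge0}x_np^n$ with $x_n\in\{0,\dots,p-1\}$; set $x_n=0$ for $n<0$; $v$ is the $p$-adic valuation, $|x|_p=p^{-v(x)}$, and $D_s=-1/\log_p|s|$. Metrics: $\hat\rho_\alpha((\xi,x),(\eta,y))=\max(|\xi-\eta|,|x-y|_p^\alpha)$ on $\mathbb{R}\times\mathbb{Z}_p$. The $p$-adic solenoid is $T_p=(\mathbb{R}\times\mathbb{Z}_p)/B$ with $B=\{(n,-n):n\in\mathbb{Z}\}$, with canonical projection $\phi$ and metric $\rho_\alpha(f,g)=\inf\{\hat\rho_\alpha(u,w):u\in f,\ w\in g\}$ (cosets $f,g$). On $\mathbb{R}\times\mathbb{C}$: $\hat d((\xi_1,z_1),(\xi_2,z_2))=\max(|\xi_1-\xi_2|,|z_1-z_2|)$. On $S_1\times\mathbb{C}$ ($S_1$ the unit circle): $d((e^{2\pi i\xi_1},z_1),(e^{2\pi i\xi_2},z_2))=\max(\inf_{n\in\mathbb{Z}}|\xi_1-\xi_2+n|,|z_1-z_2|)$. A map $\Phi:(M,\rho)\to(N,\rho')$ is an L-contraction if there is $C>0$ with $\rho'(\Phi(u),\Phi(w))\le C\rho(u,w)$ for all $u,w$; it is an L-isometry if in addition $\rho(u,w)\le C\rho'(\Phi(u),\Phi(w))$ for all $u,w$, for some $C>0$. Maps: for integers $n\ge0$, $\chi_n^{(m)}(x)=\exp\big(\frac{2\pi i}{p}\sum_{k=0}^m x_{n-k}p^{-k}\big)$ and $$\tilde\chi_n^{(m)}(\xi,x)=\exp\Big(2\pi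 i\,\xi\,\frac{\theta(p^{m-n}-|x|_p)}{p^{\min(n,m)+1}}\Big)\chi_n^{(m)}(x),$$ where $\theta$ is the indicator function of $[0,\infty]$ (so for $m=\infty$ the factor $\theta$ is $1$). These functions satisfy $\tilde\chi_n^{(m)}(\xi+l,x-l)=\tilde\chi_n^{(m)}(\xi,x)$ for all $l\in\mathbb{Z}$, $(\xi,x)\in\mathbb{R}\times\mathbb{Z}_p$, i.e. they are constant on the cosets of $B$. Put $\omega^{(m)}_s(\xi,x)=\sum_{n=0}^\infty s^n\tilde\chi_n^{(m)}(\xi,x)$ for $(\xi,x)\in\mathbb{R}\times\mathbb{Z}_p$, and ${}_\otimes\omega^{(m)}_s:\mathbb{R}\times\mathbb{Z}_p\to\mathbb{R}\times\mathbb{C}$, $(\xi,x)\mapsto(\xi,\omega^{(m)}_s(\xi,x))$. By the invariance there is the quotient map $\mho^{(m)}_s:T_p\to S_1\times\mathbb{C}$, $\mho^{(m)}_s(\phi(\xi,x))=(e^{2\pi i\xi},\omega^{(m)}_s(\xi,x))$. Define $\sigma_a:S_1\times\mathbb{C}\to\mathbb{R}^3$, $(e^{2\pi i\xi},z)\mapsto(x_1,x_2,x_3)$ by $x_1+ix_3=e^{2\pi i\xi}|a|(1+\operatorname{Re}(z/a))$, $x_2=|a|\operatorname{Im}(z/a)$, and $\Omega^{(m)}_{s,a}=\sigma_a\circ\mho^{(m)}_s$. Constants: $$\tilde\Delta^{(m)}_s=\inf_{x\ne y\in\mathbb{Z}_p,\ \xi\in\mathbb{R}}\big|s^{-v(x-y)}\big(\omega^{(m)}_s(\xi,x)-\omega^{(m)}_s(\xi,y)\big)\big|,\qquad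 \gamma^{(m)}_{s,a}=-\inf_{(\xi,x)\in\mathbb{R}\times\mathbb{Z}_p}\operatorname{Re}\big(\omega^{(m)}_s(\xi,x)/a\big).$$
   Formalization: For finite m the claimed invariance of the functions under B fails (n=m+1, ξ=0, x=0, l=1), so the quotient map ℧ is undefined; it is instead defined by evaluating at the coset representative with −1<ξ≤0, which is the quotient map whenever invariance holds (e.g. m=∞). *)

theory Defs
  imports "HOL-Analysis.Analysis" "HOL-Computational_Algebra.Primes"
    "HOL-Algebra.Coset" "HOL-Algebra.Ring"
begin

section \<open>The p-adic integers\<close>

text \<open>
  \<open>\<int>\<^sub>p\<close> is the inverse limit of the rings \<open>\<int>/p\<^sup>n\<close>: an element is a compatible sequence of
  residues, \<open>x n\<close> being the representative of \<open>x\<close> modulo \<open>p\<^sup>n\<close> in \<open>{0..<p\<^sup>n}\<close>.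
\<close>

definition padic_int :: "nat \<Rightarrow> (nat \<Rightarrow> int) ring" where
  "padic_int p = \<lparr>
     carrier = {x. \<forall>n. x n \<in> {0..<int p ^ n} \<and> x (Suc n) mod int p ^ n = x n},
     mult = (\<lambda>x y n. (x n * y n) mod int p ^ n),
     one = (\<lambda>n. 1 mod int p ^ n),
     zero = (\<lambda>n. 0),
     add = (\<lambda>x y n. (x n + y n) mod int p ^ n)\<rparr>"

definition padic_of_int :: "nat \<Rightarrow> int \<Rightarrow> nat \<Rightarrow> int" where
  "padic_of_int p k = (\<lambda>n. k mod int p ^ n)"

definition digit :: "nat \<Rightarrow> (nat \<Rightarrow> int) \<Rightarrow> int \<Rightarrow> int" where
  "digit p x j = (if j < 0 then 0 else x (Suc (nat j)) div int p ^ nat j)"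

text \<open>
  \<open>x n = 0\<close> holds iff \<open>p\<^sup>n\<close> divides \<open>x\<close>.  The value at \<open>x = 0\<close> is irrelevant.
\<close>

definition padic_val :: "(nat \<Rightarrow> int) \<Rightarrow> nat" where
  "padic_val x = (LEAST n. x (Suc n) \<noteq> 0)"

definition padic_abs :: "nat \<Rightarrow> (nat \<Rightarrow> int) \<Rightarrow> real" where
  "padic_abs p x = (if x = \<zero>\<^bsub>padic_int p\<^esub> then 0 else real p powi (- int (padic_val x)))"


section \<open>The solenoid and the metrics\<close>

definition real_group :: "real monoid" where
  "real_group = \<lparr>carrier = UNIV, mult = (+), one = 0\<rparr>"

definition RZp :: "nat \<Rightarrow> (real \<times> (nat \<Rightarrow> int)) monoid" where
  "RZp p = real_group \<times>\<times> add_monoid (padic_int p)"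

definition B :: "nat \<Rightarrow> (real \<times> (nat \<Rightarrow> int)) set" where
  "B p = {(real_of_int n, padic_of_int p (- n)) | n. True}"

definition solenoid :: "nat \<Rightarrow> (real \<times> (nat \<Rightarrow> int)) set set" where
  "solenoid p = carrier (RZp p Mod B p)"

definition phi :: "nat \<Rightarrow> real \<times> (nat \<Rightarrow> int) \<Rightarrow> (real \<times> (nat \<Rightarrow> int)) set" where
  "phi p u = B p #>\<^bsub>RZp p\<^esub> u"

definition rho_hat ::
  "nat \<Rightarrow> real \<Rightarrow> real \<times> (nat \<Rightarrow> int) \<Rightarrow> real \<times> (nat \<Rightarrow> int) \<Rightarrow> real" where
  "rho_hat p \<alpha> = (\<lambda>(\<xi>, x) (\<eta>, y).
     max \<bar>\<xi> - \<eta>\<bar> (padic_abs p (x \<ominus>\<^bsub>padic_int p\<^esub> y) powr \<alpha>))"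

definition rho ::
  "nat \<Rightarrow> real \<Rightarrow> (real \<times> (nat \<Rightarrow> int)) set \<Rightarrow> (real \<times> (nat \<Rightarrow> int)) set \<Rightarrow> real" where
  "rho p \<alpha> f g = (INF (u, w) \<in> f \<times> g. rho_hat p \<alpha> u w)"

definition d_hat :: "real \<times> complex \<Rightarrow> real \<times> complex \<Rightarrow> real" where
  "d_hat = (\<lambda>(\<xi>\<^sub>1, z\<^sub>1) (\<xi>\<^sub>2, z\<^sub>2). max \<bar>\<xi>\<^sub>1 - \<xi>\<^sub>2\<bar> (cmod (z\<^sub>1 - z\<^sub>2)))"

text \<open>
  For \<open>u\<close> on the unit circle, \<open>Arg u / (2 * pi)\<close> is one of the \<open>\<xi>\<close> with \<open>u = exp (2 \<pi> i \<xi>)\<close>;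
  the distance does not depend on this choice (lemma \<open>circle_dist_cis\<close> below).
\<close>

definition circle_dist :: "complex \<Rightarrow> complex \<Rightarrow> real" where
  "circle_dist u v = (INF n::int. \<bar>Arg u / (2 * pi) - Arg v / (2 * pi) + real_of_int n\<bar>)"

definition d_circle :: "complex \<times> complex \<Rightarrow> complex \<times> complex \<Rightarrow> real" where
  "d_circle = (\<lambda>(u\<^sub>1, z\<^sub>1) (u\<^sub>2, z\<^sub>2). max (circle_dist u\<^sub>1 u\<^sub>2) (cmod (z\<^sub>1 - z\<^sub>2)))"

definition L_contraction ::
  "'a set \<Rightarrow> ('a \<Rightarrow> 'a \<Rightarrow> real) \<Rightarrow> 'b set \<Rightarrow> ('b \<Rightarrow> 'b \<Rightarrow> real) \<Rightarrow> ('a \<Rightarrow> 'b) \<Rightarrow> bool" where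
  "L_contraction M d N d' \<Phi> \<longleftrightarrow>
     \<Phi> \<in> M \<rightarrow> N \<and> (\<exists>C>0. \<forall>u\<in>M. \<forall>w\<in>M. d' (\<Phi> u) (\<Phi> w) \<le> C * d u w)"

definition L_isometry ::
  "'a set \<Rightarrow> ('a \<Rightarrow> 'a \<Rightarrow> real) \<Rightarrow> 'b set \<Rightarrow> ('b \<Rightarrow> 'b \<Rightarrow> real) \<Rightarrow> ('a \<Rightarrow> 'b) \<Rightarrow> bool" where
  "L_isometry M d N d' \<Phi> \<longleftrightarrow>
     L_contraction M d N d' \<Phi> \<and> (\<exists>C>0. \<forall>u\<in>M. \<forall>w\<in>M. d u w \<le> C * d' (\<Phi> u) (\<Phi> w))"


section \<open>The maps\<close>

definition theta :: "ereal \<Rightarrow> real" where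
  "theta = indicator {0..\<infinity>}"

text \<open>The extended real \<open>p\<^bsup>m-n\<^esup>\<close>.\<close>

definition p_pow_diff :: "nat \<Rightarrow> enat \<Rightarrow> nat \<Rightarrow> ereal" where
  "p_pow_diff p m n = (case m of enat k \<Rightarrow> ereal (real p powi (int k - int n)) | \<infinity> \<Rightarrow> \<infinity>)"

definition chi :: "nat \<Rightarrow> enat \<Rightarrow> nat \<Rightarrow> (nat \<Rightarrow> int) \<Rightarrow> complex" where
  "chi p m n x = cis (2 * pi / real p *
     (\<Sum>\<^sub>\<infinity>k\<in>{k. enat k \<le> m}. real_of_int (digit p x (int n - int k)) / real p ^ k))"

definition chi_tilde :: "nat \<Rightarrow> enat \<Rightarrow> nat \<Rightarrow> real \<Rightarrow> (nat \<Rightarrow> int) \<Rightarrow> complex" where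
  "chi_tilde p m n \<xi> x =
     cis (2 * pi * \<xi> *
       (theta (p_pow_diff p m n - ereal (padic_abs p x)) /
        real p ^ (the_enat (min (enat n) m) + 1)))
     * chi p m n x"

definition omega :: "nat \<Rightarrow> enat \<Rightarrow> complex \<Rightarrow> real \<Rightarrow> (nat \<Rightarrow> int) \<Rightarrow> complex" where
  "omega p m s \<xi> x = (\<Sum>n. s ^ n * chi_tilde p m n \<xi> x)"

definition otimes_omega ::
  "nat \<Rightarrow> enat \<Rightarrow> complex \<Rightarrow> real \<times> (nat \<Rightarrow> int) \<Rightarrow> real \<times> complex" where
  "otimes_omega p m s = (\<lambda>(\<xi>, x). (\<xi>, omega p m s \<xi> x))"

text \<open>
  The map induced on the quotient is evaluated at the unique representative \<open>(\<xi>, x)\<close> of a coset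
  with \<open>-1 < \<xi> \<le> 0\<close>.  If \<open>omega\<close> is constant on cosets, this is the quotient map
  (lemma \<open>mho_phi\<close>); that is so for \<open>m = \<infinity>\<close> (lemma \<open>omega_invariant\<close>).  For finite \<open>m\<close> the formula
  for \<open>chi_tilde\<close> is not constant on cosets (lemma \<open>chi_tilde_not_invariant\<close>).  It does agree with
  the coset identification at the two ends of the strip \<open>-1 \<le> \<xi> \<le> 0\<close>, so that its restriction to
  this strip still defines a continuous function on the solenoid.
\<close>

definition mho ::
  "nat \<Rightarrow> enat \<Rightarrow> complex \<Rightarrow> (real \<times> (nat \<Rightarrow> int)) set \<Rightarrow> complex \<times> complex" where
  "mho p m s f = (case (THE u. u \<in> f \<and> fst u \<in> {-1<..0}) of
     (\<xi>, x) \<Rightarrow> (cis (2 * pi * \<xi>), omega p m s \<xi> x))"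

definition sigma :: "complex \<Rightarrow> complex \<times> complex \<Rightarrow> real ^ 3" where
  "sigma a = (\<lambda>(u, z). let w = u * of_real (cmod a * (1 + Re (z / a)))
     in vector [Re w, cmod a * Im (z / a), Im w])"

definition Omega ::
  "nat \<Rightarrow> enat \<Rightarrow> complex \<Rightarrow> complex \<Rightarrow> (real \<times> (nat \<Rightarrow> int)) set \<Rightarrow> real ^ 3" where
  "Omega p m s a = sigma a \<circ> mho p m s"


section \<open>The constants\<close>

definition D_exponent :: "nat \<Rightarrow> complex \<Rightarrow> real" where
  "D_exponent p s = - 1 / log (real p) (cmod s)"

definition Delta_tilde :: "nat \<Rightarrow> enat \<Rightarrow> complex \<Rightarrow> real" where
  "Delta_tilde p m s =
     (INF (x, y, \<xi>) \<in> {(x, y, \<xi>). x \<in> carrier (padic_int p) \<and> y \<in> carrier (padic_int p) \<and> x \<noteq> y}.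
        cmod (s powi (- int (padic_val (x \<ominus>\<^bsub>padic_int p\<^esub> y))) *
              (omega p m s \<xi> x - omega p m s \<xi> y)))"

definition gamma_const :: "nat \<Rightarrow> enat \<Rightarrow> complex \<Rightarrow> complex \<Rightarrow> real" where
  "gamma_const p m s a =
     - (INF (\<xi>, x) \<in> UNIV \<times> carrier (padic_int p). Re (omega p m s \<xi> x / a))"


section \<open>Basic facts\<close>

lemma padic_carrier_iff:
  "x \<in> carrier (padic_int p) \<longleftrightarrow>
     (\<forall>n. 0 \<le> x n \<and> x n < int p ^ n \<and> x (Suc n) mod int p ^ n = x n)"
  by (auto simp: padic_int_def)

lemma padic_mod_self:
  assumes "x \<in> carrier (padic_int p)"
  shows "x n mod int p ^ n = x n"
  using assms by (simp add: padic_carrier_iff)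

lemma padic_modI:
  assumes "p > 0" and "\<And>n. int p ^ n dvd f (Suc n) - f n"
  shows "(\<lambda>n. f n mod int p ^ n) \<in> carrier (padic_int p)"
proof -
  have "f (Suc n) mod int p ^ Suc n mod int p ^ n = f n mod int p ^ n" for n
    using assms(2)[of n] by (simp add: mod_mod_cancel mod_eq_dvd_iff)
  thus ?thesis using assms(1) by (simp add: padic_carrier_iff)
qed

lemma padic_dvd_step:
  assumes "x \<in> carrier (padic_int p)"
  shows "int p ^ n dvd x (Suc n) - x n"
  by (metis assms padic_carrier_iff mod_mod_trivial mod_eq_dvd_iff)

lemma padic_of_int_closed: "p > 0 \<Longrightarrow> padic_of_int p k \<in> carrier (padic_int p)"
  unfolding padic_of_int_def by (rule padic_modI) auto

lemma padic_cring:
  assumes "p > 0"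
  shows "cring (padic_int p)"
proof (rule cringI)
  let ?R = "padic_int p"
  have add: "x \<oplus>\<^bsub>?R\<^esub> y = (\<lambda>n. (x n + y n) mod int p ^ n)" for x y
    by (simp add: padic_int_def)
  have mul: "x \<otimes>\<^bsub>?R\<^esub> y = (\<lambda>n. (x n * y n) mod int p ^ n)" for x y
    by (simp add: padic_int_def)
  have zero: "\<zero>\<^bsub>?R\<^esub> = (\<lambda>n. 0)" and one: "\<one>\<^bsub>?R\<^esub> = (\<lambda>n. 1 mod int p ^ n)"
    by (simp_all add: padic_int_def)
  have zc: "\<zero>\<^bsub>?R\<^esub> \<in> carrier ?R"
    using assms by (simp add: padic_carrier_iff zero)
  have oc: "\<one>\<^bsub>?R\<^esub> \<in> carrier ?R"
    using padic_of_int_closed[OF assms, of 1] by (simp add: one padic_of_int_def)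
  have ac: "x \<oplus>\<^bsub>?R\<^esub> y \<in> carrier ?R" if "x \<in> carrier ?R" "y \<in> carrier ?R" for x y
    unfolding add
  proof (rule padic_modI[OF assms])
    fix n
    have "x (Suc n) + y (Suc n) - (x n + y n) = (x (Suc n) - x n) + (y (Suc n) - y n)" by simp
    thus "int p ^ n dvd x (Suc n) + y (Suc n) - (x n + y n)"
      using that by (metis dvd_add padic_dvd_step)
  qed
  have mc: "x \<otimes>\<^bsub>?R\<^esub> y \<in> carrier ?R" if "x \<in> carrier ?R" "y \<in> carrier ?R" for x y
    unfolding mul
  proof (rule padic_modI[OF assms])
    fix n
    have "x (Suc n) * y (Suc n) - x n * y n =
        (x (Suc n) - x n) * y (Suc n) + x n * (y (Suc n) - y n)" by (simp add: algebra_simps)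
    thus "int p ^ n dvd x (Suc n) * y (Suc n) - x n * y n"
      using that by (metis dvd_add dvd_mult dvd_mult2 padic_dvd_step)
  qed
  show "abelian_group ?R"
  proof (rule abelian_groupI)
    fix x assume x: "x \<in> carrier ?R"
    define y where "y = (\<lambda>n. (- x n) mod int p ^ n)"
    have "y \<in> carrier ?R" unfolding y_def
    proof (rule padic_modI[OF assms])
      show "int p ^ n dvd - x (Suc n) - - x n" for n
        using padic_dvd_step[OF x, of n] by (simp add: dvd_diff_commute)
    qed
    moreover have "y \<oplus>\<^bsub>?R\<^esub> x = \<zero>\<^bsub>?R\<^esub>"
      by (simp add: add zero y_def mod_simps)
    ultimately show "\<exists>y\<in>carrier ?R. y \<oplus>\<^bsub>?R\<^esub> x = \<zero>\<^bsub>?R\<^esub>" by blast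
  next
    fix x assume "x \<in> carrier ?R"
    thus "\<zero>\<^bsub>?R\<^esub> \<oplus>\<^bsub>?R\<^esub> x = x" by (simp add: add zero padic_mod_self)
  next
    fix x y assume "x \<in> carrier ?R" "y \<in> carrier ?R"
    thus "x \<oplus>\<^bsub>?R\<^esub> y = y \<oplus>\<^bsub>?R\<^esub> x" by (simp add: add add.commute)
  next
    fix x y z assume "x \<in> carrier ?R" "y \<in> carrier ?R" "z \<in> carrier ?R"
    show "x \<oplus>\<^bsub>?R\<^esub> y \<oplus>\<^bsub>?R\<^esub> z = x \<oplus>\<^bsub>?R\<^esub> (y \<oplus>\<^bsub>?R\<^esub> z)" by (simp add: add mod_simps add.assoc)
  qed (use zc ac in auto)
  show "comm_monoid ?R"
  proof (rule comm_monoidI)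
    fix x assume "x \<in> carrier ?R"
    thus "\<one>\<^bsub>?R\<^esub> \<otimes>\<^bsub>?R\<^esub> x = x" by (simp add: mul one mod_simps padic_mod_self)
  next
    fix x y assume "x \<in> carrier ?R" "y \<in> carrier ?R"
    thus "x \<otimes>\<^bsub>?R\<^esub> y = y \<otimes>\<^bsub>?R\<^esub> x" by (simp add: mul mult.commute)
  next
    fix x y z assume "x \<in> carrier ?R" "y \<in> carrier ?R" "z \<in> carrier ?R"
    show "x \<otimes>\<^bsub>?R\<^esub> y \<otimes>\<^bsub>?R\<^esub> z = x \<otimes>\<^bsub>?R\<^esub> (y \<otimes>\<^bsub>?R\<^esub> z)" by (simp add: mul mod_simps mult.assoc)
  qed (use oc mc in auto)
  fix x y z assume "x \<in> carrier ?R" "y \<in> carrier ?R" "z \<in> carrier ?R"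
  show "(x \<oplus>\<^bsub>?R\<^esub> y) \<otimes>\<^bsub>?R\<^esub> z = x \<otimes>\<^bsub>?R\<^esub> z \<oplus>\<^bsub>?R\<^esub> y \<otimes>\<^bsub>?R\<^esub> z"
    by (simp add: add mul mod_simps algebra_simps)
qed

lemma padic_add: "x \<oplus>\<^bsub>padic_int p\<^esub> y = (\<lambda>n. (x n + y n) mod int p ^ n)"
  by (simp add: padic_int_def)

lemma padic_minus:
  assumes "p > 0" "x \<in> carrier (padic_int p)" "y \<in> carrier (padic_int p)"
  shows "x \<ominus>\<^bsub>padic_int p\<^esub> y = (\<lambda>n. (x n - y n) mod int p ^ n)"
proof -
  interpret cring "padic_int p" by (rule padic_cring[OF assms(1)])
  let ?z = "x \<ominus>\<^bsub>padic_int p\<^esub> y"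
  have zc: "?z \<in> carrier (padic_int p)" using assms by simp
  have "?z \<oplus>\<^bsub>padic_int p\<^esub> y = x"
    using assms by (simp add: minus_eq a_assoc l_neg)
  hence "(?z n + y n) mod int p ^ n = x n" for n
    by (metis padic_add)
  hence "(x n - y n) mod int p ^ n = ?z n mod int p ^ n" for n
    by (metis add_diff_cancel_right' mod_diff_left_eq)
  thus ?thesis using padic_mod_self[OF zc] by (intro ext) simp
qed

text \<open>The expansion \<open>x = \<Sum>x\<^sub>n p\<^sup>n\<close>, read modulo \<open>p\<^sup>n\<close>.\<close>

lemma padic_expansion:
  assumes "x \<in> carrier (padic_int p)"
  shows "x n = (\<Sum>j<n. digit p x (int j) * int p ^ j)"
proof (induction n)
  case 0
  show ?case using assms padic_carrier_iff[of x p] by (auto dest: spec[of _ 0])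
next
  case (Suc n)
  have "x (Suc n) = x (Suc n) div int p ^ n * int p ^ n + x (Suc n) mod int p ^ n"
    by (rule div_mult_mod_eq[symmetric])
  also have "x (Suc n) mod int p ^ n = x n" using assms by (simp add: padic_carrier_iff)
  finally show ?case using Suc by (simp add: digit_def)
qed

lemma digit_range:
  assumes "p > 0" "x \<in> carrier (padic_int p)"
  shows "digit p x j \<in> {0..<int p}"
proof (cases "j < 0")
  case True
  then show ?thesis using assms by (simp add: digit_def)
next
  case False
  have "0 \<le> x (Suc (nat j))" "x (Suc (nat j)) < int p ^ nat j * int p"
    using assms(2) unfolding padic_carrier_iff by (metis, metis power_Suc2)
  moreover have "0 < int p ^ nat j" using assms by simp
  moreover from this have "\<not> int p \<le> x (Suc (nat j)) div int p ^ nat j"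
  proof (intro notI)
    assume "int p \<le> x (Suc (nat j)) div int p ^ nat j"
    hence "int p * int p ^ nat j \<le> x (Suc (nat j)) div int p ^ nat j * int p ^ nat j"
      by (rule mult_right_mono) simp
    also have "\<dots> \<le> x (Suc (nat j))"
      using div_mult_mod_eq[of "x (Suc (nat j))" "int p ^ nat j"]
        pos_mod_sign[OF \<open>0 < int p ^ nat j\<close>, of "x (Suc (nat j))"] by linarith
    finally show False
      using \<open>x (Suc (nat j)) < int p ^ nat j * int p\<close> by (simp add: mult.commute)
  qed
  ultimately show ?thesis using False
    by (simp add: digit_def pos_imp_zdiv_nonneg_iff)
qed

lemma chi_finite_sum:
  "chi p m n x = cis (2 * pi / real p *
     (\<Sum>k | k \<le> n \<and> enat k \<le> m. real_of_int (digit p x (int n - int k)) / real p ^ k))"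
proof -
  have fin: "finite {k. k \<le> n \<and> enat k \<le> m}"
    by (rule finite_subset[of _ "{..n}"]) auto
  have "(\<Sum>\<^sub>\<infinity>k\<in>{k. enat k \<le> m}. real_of_int (digit p x (int n - int k)) / real p ^ k) =
        (\<Sum>\<^sub>\<infinity>k\<in>{k. k \<le> n \<and> enat k \<le> m}. real_of_int (digit p x (int n - int k)) / real p ^ k)"
    by (rule infsum_cong_neutral) (auto simp: digit_def)
  thus ?thesis using fin by (simp add: chi_def)
qed

lemma phi_eq:
  assumes "p > 0" "x \<in> carrier (padic_int p)"
  shows "phi p (\<xi>, x) = {(\<xi> + real_of_int l, x \<ominus>\<^bsub>padic_int p\<^esub> padic_of_int p l) | l. True}"
proof -
  have "padic_of_int p (- l) \<oplus>\<^bsub>padic_int p\<^esub> x = x \<ominus>\<^bsub>padic_int p\<^esub> padic_of_int p l" for l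
    using assms padic_of_int_closed[OF assms(1)]
    by (simp add: padic_minus padic_add padic_of_int_def mod_simps)
  thus ?thesis
    unfolding phi_def r_coset_def B_def RZp_def
    by (force simp: real_group_def DirProd_def add.commute)
qed

lemma mem_solenoid_iff:
  "f \<in> solenoid p \<longleftrightarrow> (\<exists>\<xi>. \<exists>x\<in>carrier (padic_int p). f = phi p (\<xi>, x))"
  by (auto simp: solenoid_def FactGroup_def RCOSETS_def phi_def RZp_def real_group_def DirProd_def)

lemma strip_representative:
  assumes "p > 0" "f \<in> solenoid p"
  shows "\<exists>!u. u \<in> f \<and> fst u \<in> {-1<..0}"
proof -
  obtain \<xi> x where x: "x \<in> carrier (padic_int p)" and f: "f = phi p (\<xi>, x)"
    using assms(2) mem_solenoid_iff by blast
  have uniq: "l = - \<lceil>\<xi>\<rceil>" if "-1 < \<xi> + real_of_int l" "\<xi> + real_of_int l \<le> 0" for l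
    using that by linarith
  show ?thesis
  proof (rule ex1I)
    show "(\<xi> + real_of_int (- \<lceil>\<xi>\<rceil>), x \<ominus>\<^bsub>padic_int p\<^esub> padic_of_int p (- \<lceil>\<xi>\<rceil>)) \<in> f \<and>
      fst (\<xi> + real_of_int (- \<lceil>\<xi>\<rceil>), x \<ominus>\<^bsub>padic_int p\<^esub> padic_of_int p (- \<lceil>\<xi>\<rceil>)) \<in> {-1<..0}"
      (is "?A \<and> ?B")
    proof
      show ?A unfolding f phi_eq[OF assms(1) x] by blast
      show ?B by simp linarith
    qed
  next
    fix u assume "u \<in> f \<and> fst u \<in> {-1<..0}"
    then obtain l where "u = (\<xi> + real_of_int l, x \<ominus>\<^bsub>padic_int p\<^esub> padic_of_int p l)"
      and "-1 < \<xi> + real_of_int l" "\<xi> + real_of_int l \<le> 0"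
      unfolding f phi_eq[OF assms(1) x] by auto
    thus "u = (\<xi> + real_of_int (- \<lceil>\<xi>\<rceil>), x \<ominus>\<^bsub>padic_int p\<^esub> padic_of_int p (- \<lceil>\<xi>\<rceil>))"
      using uniq[of l] by blast
  qed
qed

lemma mho_phi:
  assumes "p > 0" "x \<in> carrier (padic_int p)"
    and inv: "\<And>l. omega p m s (\<xi> + real_of_int l) (x \<ominus>\<^bsub>padic_int p\<^esub> padic_of_int p l) = omega p m s \<xi> x"
  shows "mho p m s (phi p (\<xi>, x)) = (cis (2 * pi * \<xi>), omega p m s \<xi> x)"
proof -
  let ?u = "THE u. u \<in> phi p (\<xi>, x) \<and> fst u \<in> {-1<..0}"
  have "phi p (\<xi>, x) \<in> solenoid p" using assms(2) mem_solenoid_iff by blast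
  from theI'[OF strip_representative[OF assms(1) this]]
  obtain l where l: "?u = (\<xi> + real_of_int l, x \<ominus>\<^bsub>padic_int p\<^esub> padic_of_int p l)"
    unfolding phi_eq[OF assms(1,2)] by blast
  have "cis (2 * pi * (\<xi> + real_of_int l)) = cis (2 * pi * \<xi>) * cis (2 * pi * real_of_int l)"
    by (simp add: cis_mult algebra_simps)
  also have "cis (2 * pi * real_of_int l) = 1" by (rule cis_multiple_2pi) simp
  finally show ?thesis unfolding mho_def l using inv[of l] by simp
qed

lemma chi_tilde_full:
  assumes "p > 0" "x \<in> carrier (padic_int p)" "enat n \<le> m"
  shows "chi_tilde p m n \<xi> x = cis (2 * pi * ((\<xi> + real_of_int (x (Suc n))) / real p ^ Suc n))"
proof -
  have abs: "padic_abs p x \<le> 1"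
    using assms(1) by (auto simp: padic_abs_def power_int_minus field_simps)
  have th: "theta (p_pow_diff p m n - ereal (padic_abs p x)) = 1"
  proof (cases m)
    case (enat k)
    have "1 \<le> real p ^ (k - n)" using assms(1) by simp
    hence "1 \<le> real p powi (int k - int n)"
      using assms(3) enat by (simp add: power_int_def nat_diff_distrib)
    thus ?thesis using enat abs by (simp add: theta_def p_pow_diff_def)
  qed (simp add: theta_def p_pow_diff_def)
  have set: "{k. k \<le> n \<and> enat k \<le> m} = {..n}"
    using assms(3) by (auto intro: order_trans[of _ "enat n"])
  have "(\<Sum>k\<le>n. real_of_int (digit p x (int n - int k)) / real p ^ k) =
        (\<Sum>j\<le>n. real_of_int (digit p x (int j)) / real p ^ (n - j))"
    by (rule sum.reindex_bij_witness[of _ "\<lambda>j. n - j" "\<lambda>k. n - k"]) (auto simp: of_nat_diff)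
  also have "\<dots> = (\<Sum>j\<le>n. real_of_int (digit p x (int j)) * real p ^ j / real p ^ n)"
    using assms(1) by (intro sum.cong refl) (simp add: power_diff)
  also have "\<dots> = real_of_int (\<Sum>j<Suc n. digit p x (int j) * int p ^ j) / real p ^ n"
    by (simp add: sum_divide_distrib lessThan_Suc_atMost del: sum.lessThan_Suc)
  also have "\<dots> = real_of_int (x (Suc n)) / real p ^ n"
    using padic_expansion[OF assms(2), of "Suc n"] by simp
  finally have "chi p m n x = cis (2 * pi / real p * (real_of_int (x (Suc n)) / real p ^ n))"
    by (simp add: chi_finite_sum set)
  moreover have "the_enat (min (enat n) m) = n" using assms(3) by (simp add: min_absorb1)
  ultimately show ?thesis
    unfolding chi_tilde_def th by (simp add: cis_mult add_divide_distrib algebra_simps)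
qed

lemma omega_invariant:
  assumes "p > 0" "x \<in> carrier (padic_int p)"
  shows "omega p \<infinity> s (\<xi> + real_of_int l) (x \<ominus>\<^bsub>padic_int p\<^esub> padic_of_int p l) = omega p \<infinity> s \<xi> x"
proof -
  let ?y = "x \<ominus>\<^bsub>padic_int p\<^esub> padic_of_int p l"
  interpret cring "padic_int p" by (rule padic_cring[OF assms(1)])
  have yc: "?y \<in> carrier (padic_int p)" using assms padic_of_int_closed[OF assms(1)] by simp
  have "chi_tilde p \<infinity> n (\<xi> + real_of_int l) ?y = chi_tilde p \<infinity> n \<xi> x" for n
  proof -
    have "?y (Suc n) = (x (Suc n) - l) mod int p ^ Suc n"
      using padic_minus[OF assms padic_of_int_closed[OF assms(1)], of l]
      by (simp add: padic_of_int_def mod_simps)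
    then obtain t where "x (Suc n) - l = ?y (Suc n) + int p ^ Suc n * t"
      by (metis mod_div_mult_eq mult.commute)
    hence "real_of_int (x (Suc n) - l) = real_of_int (?y (Suc n) + int p ^ Suc n * t)" by simp
    hence eq: "\<xi> + real_of_int (x (Suc n)) =
        (\<xi> + real_of_int l + real_of_int (?y (Suc n))) + real p ^ Suc n * real_of_int t" by simp
    have "(\<xi> + real_of_int (x (Suc n))) / real p ^ Suc n =
        (\<xi> + real_of_int l + real_of_int (?y (Suc n))) / real p ^ Suc n + real_of_int t"
      unfolding eq using assms(1) by (subst add_divide_distrib) simp
    moreover have "cis (2 * pi * (r + real_of_int t)) = cis (2 * pi * r)" for r
    proof -
      have "cis (2 * pi * (r + real_of_int t)) = cis (2 * pi * r) * cis (2 * pi * real_of_int t)"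
        by (simp add: cis_mult algebra_simps)
      also have "cis (2 * pi * real_of_int t) = 1" by (rule cis_multiple_2pi) simp
      finally show ?thesis by simp
    qed
    ultimately show ?thesis
      using chi_tilde_full[OF assms(1) yc, of n \<infinity> "\<xi> + real_of_int l"]
        chi_tilde_full[OF assms, of n \<infinity> \<xi>] by simp
  qed
  thus ?thesis by (simp add: omega_def)
qed

lemma chi_tilde_not_invariant:
  fixes k :: nat
  assumes "p > 1"
  shows "chi_tilde p (enat k) (Suc k) (0 + real_of_int 1) (\<zero>\<^bsub>padic_int p\<^esub> \<ominus>\<^bsub>padic_int p\<^esub> padic_of_int p 1)
           \<noteq> chi_tilde p (enat k) (Suc k) 0 \<zero>\<^bsub>padic_int p\<^esub>"
proof -
  have p0: "p > 0" using assms by simp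
  interpret cring "padic_int p" by (rule padic_cring[OF p0])
  let ?y = "\<zero>\<^bsub>padic_int p\<^esub> \<ominus>\<^bsub>padic_int p\<^esub> padic_of_int p 1"
  have y: "?y n = int p ^ n - 1" for n
  proof -
    have "?y n = (- 1) mod int p ^ n"
      using padic_minus[OF p0 zero_closed padic_of_int_closed[OF p0], of 1]
      by (simp add: padic_of_int_def padic_int_def mod_simps)
    also have "\<dots> = (int p ^ n - 1) mod int p ^ n"
      by (metis add_uminus_conv_diff add.commute mod_add_self2)
    also have "\<dots> = int p ^ n - 1" using p0 by (intro mod_pos_pos_trivial) auto
    finally show ?thesis .
  qed
  have "?y 1 \<noteq> 0" using assms by (simp add: y)
  hence y1: "?y \<noteq> \<zero>\<^bsub>padic_int p\<^esub>" by (auto simp: padic_int_def)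
  have "padic_val ?y = 0"
    unfolding padic_val_def using \<open>?y 1 \<noteq> 0\<close> by (intro Least_eq_0) simp
  hence "padic_abs p ?y = 1" using y1 by (simp add: padic_abs_def)
  moreover have "p_pow_diff p (enat k) (Suc k) = ereal (1 / real p)"
    by (simp add: p_pow_diff_def power_int_def inverse_eq_divide)
  ultimately have th: "theta (p_pow_diff p (enat k) (Suc k) - ereal (padic_abs p ?y)) = 0"
    using assms by (simp add: theta_def)
  have dig: "digit p ?y j = int p - 1" if j: "j \<ge> 0" for j
  proof -
    have "int p ^ Suc (nat j) - 1 = (int p ^ nat j - 1) + (int p - 1) * int p ^ nat j"
      by (simp add: algebra_simps)
    moreover have "((int p ^ nat j - 1) + (int p - 1) * int p ^ nat j) div int p ^ nat j = int p - 1"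
    proof -
      have "(int p ^ nat j - 1) div int p ^ nat j = 0"
        using p0 by (intro div_pos_pos_trivial) auto
      thus ?thesis using p0 by simp
    qed
    ultimately show ?thesis using j by (simp only: digit_def y) simp
  qed
  have set: "{i. i \<le> Suc k \<and> enat i \<le> enat k} = {..k}" by auto
  have geo: "(\<Sum>i\<le>k. (real p - 1) / real p ^ i) = real p - 1 / real p ^ k"
  proof (induction k)
    case (Suc k)
    have "(real p - 1) / real p ^ Suc k = 1 / real p ^ k - 1 / real p ^ Suc k"
      using assms by (simp add: field_simps)
    thus ?case using Suc by simp
  qed simp
  have "(\<Sum>i\<le>k. real_of_int (digit p ?y (int (Suc k) - int i)) / real p ^ i) = (\<Sum>i\<le>k. (real p - 1) / real p ^ i)"
    by (intro sum.cong refl) (subst dig, auto)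
  hence "chi p (enat k) (Suc k) ?y = cis (2 * pi / real p * (real p - 1 / real p ^ k))"
    unfolding chi_finite_sum set geo by simp
  also have "2 * pi / real p * (real p - 1 / real p ^ k) = 2 * pi + - (2 * pi / real p ^ Suc k)"
    using assms by (simp add: field_simps)
  also have "cis \<dots> = cis (- (2 * pi / real p ^ Suc k))"
    by (subst cis_mult[symmetric]) simp
  finally have chi: "chi p (enat k) (Suc k) ?y = cis (- (2 * pi / real p ^ Suc k))" .
  have "digit p \<zero>\<^bsub>padic_int p\<^esub> j = 0" for j by (simp add: digit_def padic_int_def)
  hence one: "chi_tilde p (enat k) (Suc k) 0 \<zero>\<^bsub>padic_int p\<^esub> = 1"
    by (simp add: chi_tilde_def chi_finite_sum)
  have ne: "cis (- (2 * pi / real p ^ Suc k)) \<noteq> 1"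
  proof
    assume "cis (- (2 * pi / real p ^ Suc k)) = 1"
    hence "cos (2 * pi / real p ^ Suc k) = 1"
      by (metis cis.sel(1) cos_minus one_complex.sel(1))
    then obtain z :: int where z: "2 * pi / real p ^ Suc k = real_of_int z * 2 * pi"
      by (auto simp: cos_one_2pi_int)
    hence "pi * (2 * (1 / real p ^ Suc k)) = pi * (2 * real_of_int z)"
      by (simp add: mult_ac del: power_Suc)
    hence "1 / real p ^ Suc k = real_of_int z"
      by (simp only: mult_cancel_left pi_neq_zero) simp
    moreover have "1 < real p ^ Suc k" using assms by (intro one_less_power) auto
    hence "0 < 1 / real p ^ Suc k" "1 / real p ^ Suc k < 1"
      using p0 by (auto simp: divide_less_eq simp del: power_Suc)
    ultimately have "0 < real_of_int z" "real_of_int z < 1" by (simp_all only:)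
    thus False by simp
  qed
  show ?thesis
    unfolding one using ne chi th by (simp add: chi_tilde_def)
qed

lemma circle_dist_cis:
  "circle_dist (cis (2 * pi * \<xi>)) (cis (2 * pi * \<eta>)) = (INF n::int. \<bar>\<xi> - \<eta> + real_of_int n\<bar>)"
proof -
  have lift: "\<exists>k::int. Arg (cis (2 * pi * r)) / (2 * pi) = r + real_of_int k" for r
  proof -
    have "cis (Arg (cis (2 * pi * r))) = cis (2 * pi * r)"
      using cis_Arg[of "cis (2 * pi * r)"] by (simp add: sgn_div_norm)
    hence "sin (Arg (cis (2 * pi * r))) = sin (2 * pi * r) \<and> cos (Arg (cis (2 * pi * r))) = cos (2 * pi * r)"
      by (simp add: complex_eq_iff)
    then obtain k :: int where "Arg (cis (2 * pi * r)) = 2 * pi * r + 2 * pi * of_int k"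
      by (metis sin_cos_eq_iff)
    hence "Arg (cis (2 * pi * r)) / (2 * pi) = r + real_of_int k" by (simp add: field_simps)
    thus ?thesis ..
  qed
  obtain j k :: int where jk: "Arg (cis (2 * pi * \<xi>)) / (2 * pi) = \<xi> + real_of_int j"
    "Arg (cis (2 * pi * \<eta>)) / (2 * pi) = \<eta> + real_of_int k"
    using lift by meson
  let ?f = "\<lambda>n::int. \<bar>\<xi> - \<eta> + real_of_int n\<bar>"
  have "range (\<lambda>n::int. \<bar>\<xi> + real_of_int j - (\<eta> + real_of_int k) + real_of_int n\<bar>) = range ?f"
  proof (intro equalityI subsetI)
    fix r assume "r \<in> range (\<lambda>n::int. \<bar>\<xi> + real_of_int j - (\<eta> + real_of_int k) + real_of_int n\<bar>)"
    then obtain n where "r = \<bar>\<xi> + real_of_int j - (\<eta> + real_of_int k) + real_of_int n\<bar>" by blast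
    hence "r = ?f (n + j - k)" by (simp add: algebra_simps)
    thus "r \<in> range ?f" by blast
  next
    fix r assume "r \<in> range ?f"
    then obtain n where "r = ?f n" by blast
    hence "r = \<bar>\<xi> + real_of_int j - (\<eta> + real_of_int k) + real_of_int (n - j + k)\<bar>"
      by (simp add: algebra_simps)
    thus "r \<in> range (\<lambda>n::int. \<bar>\<xi> + real_of_int j - (\<eta> + real_of_int k) + real_of_int n\<bar>)" by blast
  qed
  thus ?thesis unfolding circle_dist_def jk by simp
qed

end

theory Submission
  imports Defs
begin

text \<open>
  For \<open>\<alpha> = 1 / D\<^sub>s\<close> one has \<open>p\<^bsup>-N\<alpha>\<^esup> = \<bar>s\<bar>\<^sup>N\<close>, so the term \<open>\<bar>x - y\<bar>\<^sub>p\<^sup>\<alpha>\<close> of the metric is \<open>\<bar>s\<bar>\<^bsup>v(x-y)\<^esup>\<close>,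
  here called \<open>sdist s x y\<close>.  The \<open>n\<close>-th term of \<open>\<omega>\<close> depends only on \<open>\<xi>\<close> and on \<open>x\<close> modulo \<open>p\<^bsup>n+1\<^esup>\<close>, so
  points with \<open>v(x-y) = N\<close> share the first \<open>N\<close> terms, and the geometric tail is of order \<open>\<bar>s\<bar>\<^sup>N\<close>.
  Together with the Lipschitz bound in \<open>\<xi>\<close> this makes \<open>\<omega>\<close> Lipschitz (\<open>omega_Lipschitz\<close>).  The constant
  \<open>\<Delta>\<close> is by definition the lower bound \<open>\<bar>\<omega>(\<xi>,x) - \<omega>(\<xi>,y)\<bar> \<ge> \<Delta> \<bar>s\<bar>\<^bsup>v(x-y)\<^esup>\<close> on each fibre, and the
  Lipschitz bound in \<open>\<xi>\<close> carries it over to different fibres (\<open>omega_expansive\<close>).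

  On the solenoid, every coset has one representative in the strip \<open>-1 < \<xi> \<le> 0\<close>, and the quotient
  distance is the infimum over the translates \<open>(\<eta> + j, y - j)\<close> of one of the two representatives
  (\<open>rho_phi\<close>).  For finite \<open>m\<close> the function \<open>\<omega>\<close> is not invariant under \<open>B\<close>, so these translates cannot
  simply be inserted into \<open>\<omega>\<close>.  What holds for every \<open>m\<close> is that the two ends of the strip are glued
  correctly: \<open>\<omega>(0, y - 1) = \<omega>(-1, y)\<close> (\<open>omega_glue\<close>), because adding \<open>1\<close> to \<open>x\<close> carries into the digits
  seen by \<open>\<chi>\<close> exactly when the factor \<open>\<theta>\<close> is switched on at \<open>x + 1\<close>.  This is enough.  For \<open>j = 0\<close> both points lie in the
  strip; for \<open>j = \<plusminus>1\<close> the path from one point to the other passes through an end of the strip, and both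
  estimates can be made piecewise (\<open>omega_across\<close>); for \<open>\<bar>j\<bar> \<ge> 2\<close> the points are at distance at least \<open>1\<close>,
  and boundedness of \<open>\<omega>\<close> suffices for the upper estimate.  The lower estimate is only needed for the
  \<open>j\<close> that realises the distance on the circle, and there \<open>\<bar>j\<bar> \<le> 1\<close>.

  Finally, \<open>\<sigma>\<^sub>a\<close> writes \<open>(u, z)\<close> in cylindrical coordinates with radius \<open>R = \<bar>a\<bar>(1 + Re (z/a))\<close>.  It is Lipschitz for
  bounded \<open>z\<close>, and it can be inverted with a Lipschitz bound as long as \<open>R\<close> stays away from \<open>0\<close>; the
  condition \<open>\<gamma> < 1\<close> guarantees this on the image of the solenoid.
\<close>


section \<open>Residues, valuation and translation in the p-adic integers\<close>

lemma padic_residue_mod: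
  assumes "x \<in> carrier (padic_int p)" "i \<le> j"
  shows "x j mod int p ^ i = x i"
  using assms(2)
proof (induction j rule: dec_induct)
  case base
  show ?case using assms(1) by (rule padic_mod_self)
next
  case (step j)
  have "x (Suc j) mod int p ^ i = x (Suc j) mod int p ^ j mod int p ^ i"
    using step.hyps by (simp add: mod_mod_cancel le_imp_power_dvd)
  thus ?case using step.IH assms(1) by (simp add: padic_carrier_iff)
qed

lemma padic_at_0:
  assumes "x \<in> carrier (padic_int p)"
  shows "x 0 = 0"
  using assms padic_carrier_iff[of x p] by (auto dest: spec[of _ 0])

lemma padic_zero: "\<zero>\<^bsub>padic_int p\<^esub> = (\<lambda>n. 0)"
  by (simp add: padic_int_def)

lemma residue_eq_0_iff:
  assumes x: "x \<in> carrier (padic_int p)" and "x \<noteq> \<zero>\<^bsub>padic_int p\<^esub>"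
  shows "x r = 0 \<longleftrightarrow> r \<le> padic_val x"
proof -
  have "\<exists>n. x (Suc n) \<noteq> 0"
  proof (rule ccontr)
    assume "\<not> ?thesis"
    hence "x n = 0" for n using padic_at_0[OF x] by (cases n) auto
    thus False using assms(2) by (auto simp: padic_zero)
  qed
  hence nz: "x (Suc (padic_val x)) \<noteq> 0"
    unfolding padic_val_def by (rule LeastI_ex)
  show ?thesis
  proof
    assume "r \<le> padic_val x"
    thus "x r = 0"
    proof (cases r)
      case (Suc k)
      thus ?thesis using \<open>r \<le> padic_val x\<close> not_less_Least[of k "\<lambda>n. x (Suc n) \<noteq> 0"]
        by (auto simp: padic_val_def)
    qed (use padic_at_0[OF x] in auto)
  next
    assume "x r = 0"
    show "r \<le> padic_val x"
    proof (rule ccontr)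
      assume "\<not> ?thesis"
      hence "x r mod int p ^ Suc (padic_val x) = x (Suc (padic_val x))"
        by (intro padic_residue_mod[OF x]) simp
      thus False using nz \<open>x r = 0\<close> by simp
    qed
  qed
qed

lemma padic_abs_le_iff:
  assumes "p > 1" and x: "x \<in> carrier (padic_int p)"
  shows "padic_abs p x \<le> real p powi (- int r) \<longleftrightarrow> x r = 0"
proof (cases "x = \<zero>\<^bsub>padic_int p\<^esub>")
  case True
  thus ?thesis by (simp add: padic_abs_def padic_zero)
next
  case False
  have "real p powi (- int (padic_val x)) \<le> real p powi (- int r) \<longleftrightarrow> r \<le> padic_val x"
    using assms(1) by (simp add: power_int_minus)
  thus ?thesis using False residue_eq_0_iff[OF x False] by (simp add: padic_abs_def)
qed

text \<open>
  The distance \<open>\<bar>x - y\<bar>\<^sub>p\<^sup>\<alpha>\<close> for \<open>\<alpha> = 1 / D\<^sub>s\<close> (lemma \<open>padic_abs_powr_eq_sdist\<close>).  The valuation of \<open>x - y\<close> is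
  expressed by the first residue at which \<open>x\<close> and \<open>y\<close> differ, so that symmetry and translation
  invariance can be read off from \<open>sdist_cong\<close> without computing differences.
\<close>

definition sdist :: "complex \<Rightarrow> (nat \<Rightarrow> int) \<Rightarrow> (nat \<Rightarrow> int) \<Rightarrow> real" where
  "sdist s x y = (if x = y then 0 else cmod s ^ (LEAST n. x (Suc n) \<noteq> y (Suc n)))"

lemma sdist_nonneg: "0 \<le> sdist s x y"
  by (simp add: sdist_def)

lemma sdist_cong:
  assumes "\<And>n. x n = y n \<longleftrightarrow> x' n = y' n"
  shows "sdist s x y = sdist s x' y'"
  using assms by (simp add: sdist_def fun_eq_iff)

lemma sdist_commute: "sdist s x y = sdist s y x"
  by (rule sdist_cong) auto

lemma padic_minus_eq_0_iff:
  assumes "p > 0" "x \<in> carrier (padic_int p)" "y \<in> carrier (padic_int p)"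
  shows "(x \<ominus>\<^bsub>padic_int p\<^esub> y) n = 0 \<longleftrightarrow> x n = y n"
proof -
  have "(x \<ominus>\<^bsub>padic_int p\<^esub> y) n = 0 \<longleftrightarrow> x n mod int p ^ n = y n mod int p ^ n"
    unfolding padic_minus[OF assms] by (simp add: mod_eq_dvd_iff mod_eq_0_iff_dvd)
  thus ?thesis using assms by (simp add: padic_mod_self)
qed

lemma padic_minus_eq_zero_iff:
  assumes "p > 0" "x \<in> carrier (padic_int p)" "y \<in> carrier (padic_int p)"
  shows "x \<ominus>\<^bsub>padic_int p\<^esub> y = \<zero>\<^bsub>padic_int p\<^esub> \<longleftrightarrow> x = y"
  using padic_minus_eq_0_iff[OF assms] by (auto simp: padic_zero fun_eq_iff)

lemma sdist_eq_power_val: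
  assumes "p > 0" "x \<in> carrier (padic_int p)" "y \<in> carrier (padic_int p)" "x \<noteq> y"
  shows "sdist s x y = cmod s ^ padic_val (x \<ominus>\<^bsub>padic_int p\<^esub> y)"
  using assms(4) by (simp add: sdist_def padic_val_def padic_minus_eq_0_iff[OF assms(1-3)])

lemma padic_minus_closed:
  assumes "p > 0" "x \<in> carrier (padic_int p)" "y \<in> carrier (padic_int p)"
  shows "x \<ominus>\<^bsub>padic_int p\<^esub> y \<in> carrier (padic_int p)"
proof -
  interpret cring "padic_int p" by (rule padic_cring[OF assms(1)])
  show ?thesis using assms by simp
qed

text \<open>Under \<open>B\<close>, the point \<open>(\<xi>, x)\<close> is identified with \<open>(\<xi> + k, shift p x k)\<close>.\<close>

abbreviation shift :: "nat \<Rightarrow> (nat \<Rightarrow> int) \<Rightarrow> int \<Rightarrow> nat \<Rightarrow> int" where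
  "shift p x k \<equiv> x \<ominus>\<^bsub>padic_int p\<^esub> padic_of_int p k"

lemma shift_closed:
  assumes "p > 0" "x \<in> carrier (padic_int p)"
  shows "shift p x k \<in> carrier (padic_int p)"
  using assms by (intro padic_minus_closed padic_of_int_closed)

lemma shift_residue:
  assumes "p > 0" "x \<in> carrier (padic_int p)"
  shows "shift p x k n = (x n - k) mod int p ^ n"
  using padic_minus[OF assms padic_of_int_closed[OF assms(1)]]
  by (simp add: padic_of_int_def mod_simps)

lemma shift_0:
  assumes "p > 0" "x \<in> carrier (padic_int p)"
  shows "shift p x 0 = x"
  using assms by (simp add: fun_eq_iff shift_residue padic_mod_self)

lemma shift_shift:
  assumes "p > 0" "x \<in> carrier (padic_int p)"
  shows "shift p (shift p x k) l = shift p x (k + l)"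
  using assms by (simp add: fun_eq_iff shift_residue shift_closed mod_simps algebra_simps)

lemma sdist_shift:
  assumes "p > 0" "x \<in> carrier (padic_int p)" "y \<in> carrier (padic_int p)"
  shows "sdist s (shift p x k) (shift p y l) = sdist s x (shift p y (l - k))"
proof (rule sdist_cong)
  fix n
  have "x n = shift p y (l - k) n \<longleftrightarrow> x n mod int p ^ n = (y n - (l - k)) mod int p ^ n"
    using assms by (simp add: shift_residue padic_mod_self)
  also have "\<dots> \<longleftrightarrow> (x n - k) mod int p ^ n = (y n - l) mod int p ^ n"
    by (simp add: mod_eq_dvd_iff algebra_simps)
  finally show "shift p x k n = shift p y l n \<longleftrightarrow> x n = shift p y (l - k) n"
    using assms by (simp add: shift_residue)
qed

text \<open>
  Since \<open>1 / D\<^sub>s = - log\<^sub>p \<bar>s\<bar>\<close>, raising \<open>p\<^bsup>-v\<^esup>\<close> to this power gives \<open>p\<^bsup>v log\<^sub>p \<bar>s\<bar>\<^esup> = \<bar>s\<bar>\<^sup>v\<close>.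
\<close>

lemma padic_abs_powr_eq_sdist:
  assumes "p > 1" "0 < cmod s" "cmod s < 1"
    and x: "x \<in> carrier (padic_int p)" and y: "y \<in> carrier (padic_int p)"
  shows "padic_abs p (x \<ominus>\<^bsub>padic_int p\<^esub> y) powr (1 / D_exponent p s) = sdist s x y"
proof -
  let ?v = "padic_val (x \<ominus>\<^bsub>padic_int p\<^esub> y)"
  have p: "p > 0" "real p > 1" using assms(1) by auto
  have "(real p powi (- int ?v)) powr (1 / D_exponent p s) =
      (real p powr (- real ?v)) powr (- log (real p) (cmod s))"
    using p by (simp add: D_exponent_def powr_minus powr_realpow power_int_minus)
  also have "\<dots> = (real p powr log (real p) (cmod s)) powr real ?v"
    by (simp add: powr_powr mult.commute)
  also have "\<dots> = cmod s ^ ?v"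
    using p assms(2) by (simp add: powr_realpow)
  finally show ?thesis
    using padic_minus_eq_zero_iff[OF p(1) x y] sdist_eq_power_val[OF p(1) x y]
    by (auto simp: padic_abs_def sdist_def)
qed


section \<open>The functions \<open>chi_tilde\<close>\<close>

lemma cis_2pi_add_int: "cis (2 * pi * (r + real_of_int t)) = cis (2 * pi * r)"
proof -
  have "cis (2 * pi * (r + real_of_int t)) = cis (2 * pi * r) * cis (2 * pi * real_of_int t)"
    by (simp add: cis_mult algebra_simps)
  also have "cis (2 * pi * real_of_int t) = 1" by (rule cis_multiple_2pi) simp
  finally show ?thesis by simp
qed

text \<open>
  By the digit expansion, \<open>digit j * p\<^sup>j\<close> is the difference of two consecutive residues, so the sum
  telescopes.
\<close>

lemma digit_sum:
  assumes "p > 0" and x: "x \<in> carrier (padic_int p)" and "\<mu> \<le> n"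
  shows "(\<Sum>k\<le>\<mu>. real_of_int (digit p x (int n - int k)) / real p ^ k) =
    real_of_int (x (Suc n) - x (n - \<mu>)) / real p ^ n"
proof -
  have "real_of_int (digit p x (int n - int k)) / real p ^ k =
      (real_of_int (x (Suc (n - k))) - real_of_int (x (n - k))) / real p ^ n" if "k \<le> n" for k
  proof -
    have "x (Suc (n - k)) - x (n - k) = digit p x (int (n - k)) * int p ^ (n - k)"
      using padic_expansion[OF x, of "Suc (n - k)"] padic_expansion[OF x, of "n - k"] by simp
    hence "real_of_int (x (Suc (n - k)) - x (n - k)) =
        real_of_int (digit p x (int (n - k)) * int p ^ (n - k))" by simp
    moreover have "real p ^ n = real p ^ (n - k) * real p ^ k"
      using that by (simp flip: power_add)
    ultimately show ?thesis using assms(1) that by (simp add: of_nat_diff)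
  qed
  hence "(\<Sum>k\<le>\<mu>. real_of_int (digit p x (int n - int k)) / real p ^ k) =
      (\<Sum>k\<le>\<mu>. real_of_int (x (Suc (n - k))) - real_of_int (x (n - k))) / real p ^ n"
    using assms(3) by (simp add: sum_divide_distrib)
  also have "(\<Sum>k\<le>\<mu>. real_of_int (x (Suc (n - k))) - real_of_int (x (n - k))) =
      real_of_int (x (Suc n) - x (n - \<mu>))"
    using assms(3)
  proof (induction \<mu>)
    case (Suc \<mu>)
    hence "Suc (n - Suc \<mu>) = n - \<mu>" by simp
    thus ?case using Suc by simp
  qed simp
  finally show ?thesis .
qed

text \<open>
  The number \<open>max (n - m) 0\<close> of low digits that do not enter \<open>chi p m n\<close>.
\<close>

definition cutoff :: "enat \<Rightarrow> nat \<Rightarrow> nat" where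
  "cutoff m n = n - the_enat (min (enat n) m)"

lemma cutoff_le: "cutoff m n \<le> n"
  by (simp add: cutoff_def)

text \<open>
  The factor \<open>\<theta>\<close> is switched on exactly when all the digits below the cutoff vanish.
\<close>

lemma theta_eq:
  assumes "p > 1" and x: "x \<in> carrier (padic_int p)"
  shows "theta (p_pow_diff p m n - ereal (padic_abs p x)) = (if x (cutoff m n) = 0 then 1 else 0)"
proof (cases "enat n \<le> m")
  case True
  have "x 0 = 0" by (rule padic_at_0[OF x])
  have abs: "padic_abs p x \<le> 1"
    using padic_abs_le_iff[OF assms, of 0] \<open>x 0 = 0\<close> by simp
  have "theta (p_pow_diff p m n - ereal (padic_abs p x)) = 1"
  proof (cases m)
    case (enat k)
    have "1 \<le> real p ^ (k - n)" using assms(1) by simp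
    hence "1 \<le> real p powi (int k - int n)"
      using True enat by (simp add: power_int_def nat_diff_distrib)
    thus ?thesis using enat abs by (simp add: theta_def p_pow_diff_def)
  qed (simp add: theta_def p_pow_diff_def)
  thus ?thesis using True \<open>x 0 = 0\<close> by (simp add: cutoff_def min_absorb1)
next
  case False
  then obtain k where k: "m = enat k" "k < n" by (cases m) auto
  hence "cutoff m n = n - k" by (simp add: cutoff_def)
  moreover have "p_pow_diff p m n = ereal (real p powi (- int (n - k)))"
    using k by (simp add: p_pow_diff_def of_nat_diff)
  ultimately show ?thesis
    using padic_abs_le_iff[OF assms, of "n - k"] by (simp add: theta_def indicator_def)
qed

text \<open>
  The digits seen by \<open>chi\<close> make up \<open>x - x r\<close> modulo \<open>p\<^bsup>n+1\<^esup>\<close>.  As \<open>x\<close> runs through the integers, this is a step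
  function that jumps by \<open>p\<^sup>r\<close> at each multiple of \<open>p\<^sup>r\<close>, and for \<open>-1 \<le> \<xi> \<le> 0\<close> the \<open>\<xi>\<close>-term interpolates linearly
  across the jump.
\<close>

lemma chi_tilde_eq:
  fixes m n p
  defines "r \<equiv> cutoff m n"
  assumes p: "p > 1" and x: "x \<in> carrier (padic_int p)"
  shows "chi_tilde p m n \<xi> x =
    cis (2 * pi * ((\<xi> * (if x r = 0 then real p ^ r else 0) + real_of_int (x (Suc n) - x r)) / real p ^ Suc n))"
proof -
  define \<mu> where "\<mu> = the_enat (min (enat n) m)"
  have \<mu>: "\<mu> \<le> n" "r = n - \<mu>"
    unfolding r_def cutoff_def \<mu>_def by (cases m; simp add: min_def)+
  have set: "{k. k \<le> n \<and> enat k \<le> m} = {..\<mu>}"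
    unfolding \<mu>_def by (cases m) (auto simp: min_def)
  have chi: "chi p m n x = cis (2 * pi / real p * (real_of_int (x (Suc n) - x r) / real p ^ n))"
    unfolding chi_finite_sum set \<mu>(2) using p \<mu>(1) by (subst digit_sum[OF _ x]) auto
  have pw: "real p ^ Suc n = real p ^ r * real p ^ (\<mu> + 1)"
    using \<mu> by (simp flip: power_add)
  have "\<xi> * (theta (p_pow_diff p m n - ereal (padic_abs p x)) / real p ^ (\<mu> + 1)) =
      \<xi> * (if x r = 0 then real p ^ r else 0) / real p ^ Suc n"
    unfolding theta_eq[OF p x] r_def[symmetric] pw using p by simp
  moreover have "2 * pi / real p * (real_of_int (x (Suc n) - x r) / real p ^ n) =
      2 * pi * (real_of_int (x (Suc n) - x r) / real p ^ Suc n)"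
    by simp
  ultimately show ?thesis
    unfolding chi_tilde_def chi \<mu>_def[symmetric] mult.assoc
    by (simp only: cis_mult mult.assoc add_divide_distrib distrib_left)
qed

lemma chi_tilde_cong:
  assumes "p > 1" "x \<in> carrier (padic_int p)" "y \<in> carrier (padic_int p)" "x (Suc n) = y (Suc n)"
  shows "chi_tilde p m n \<xi> x = chi_tilde p m n \<xi> y"
proof -
  have "x (cutoff m n) = y (cutoff m n)"
    using padic_residue_mod[OF assms(2), of "cutoff m n" "Suc n"]
      padic_residue_mod[OF assms(3), of "cutoff m n" "Suc n"] cutoff_le[of m n] assms(4) by simp
  thus ?thesis using assms by (simp add: chi_tilde_eq)
qed

lemma norm_chi_tilde: "cmod (chi_tilde p m n \<xi> x) = 1"
  by (simp add: chi_tilde_def chi_def norm_mult)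

lemma norm_cis_diff: "cmod (cis a - cis b) = 2 * \<bar>sin ((a - b) / 2)\<bar>"
proof -
  have "cis a - cis b = cis b * (exp (\<i> * of_real (a - b)) - 1)"
    by (simp add: cis_conv_exp algebra_simps flip: exp_add)
  thus ?thesis by (simp only: norm_mult norm_cis dist_exp_i_1 mult_1)
qed

lemma cis_Lipschitz: "cmod (cis a - cis b) \<le> \<bar>a - b\<bar>"
  using abs_sin_x_le_abs_x[of "(a - b) / 2"] by (simp add: norm_cis_diff)

lemma chi_tilde_Lipschitz:
  assumes "p > 1"
  shows "cmod (chi_tilde p m n \<xi> x - chi_tilde p m n \<eta> x) \<le> 2 * pi * \<bar>\<xi> - \<eta>\<bar>"
proof -
  define c where "c = theta (p_pow_diff p m n - ereal (padic_abs p x)) / real p ^ (the_enat (min (enat n) m) + 1)"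
  have pp: "1 \<le> real p ^ (the_enat (min (enat n) m) + 1)"
    using assms by (intro one_le_power) simp
  have th: "0 \<le> theta (p_pow_diff p m n - ereal (padic_abs p x))"
    "theta (p_pow_diff p m n - ereal (padic_abs p x)) \<le> 1"
    by (simp_all add: theta_def indicator_def)
  have c: "0 \<le> c" "c \<le> 1"
    using pp th unfolding c_def zero_le_divide_iff divide_le_eq_1 by linarith+
  have "cmod (chi_tilde p m n \<xi> x - chi_tilde p m n \<eta> x) =
      cmod ((cis (2 * pi * \<xi> * c) - cis (2 * pi * \<eta> * c)) * chi p m n x)"
    by (simp add: chi_tilde_def c_def left_diff_distrib)
  also have "\<dots> = cmod (cis (2 * pi * \<xi> * c) - cis (2 * pi * \<eta> * c))"
    by (simp add: norm_mult chi_def)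
  also have "\<dots> \<le> \<bar>2 * pi * \<xi> * c - 2 * pi * \<eta> * c\<bar>" by (rule cis_Lipschitz)
  also have "\<dots> = (2 * pi * \<bar>\<xi> - \<eta>\<bar>) * c"
    using c by (simp add: abs_mult flip: left_diff_distrib right_diff_distrib)
  also have "\<dots> \<le> (2 * pi * \<bar>\<xi> - \<eta>\<bar>) * 1" using c by (intro mult_left_mono) auto
  finally show ?thesis by simp
qed

text \<open>
  The ends of the strip \<open>-1 \<le> \<xi> \<le> 0\<close> are glued correctly.  Put \<open>x = y - 1\<close>.  If \<open>p\<^sup>r\<close> does not divide \<open>y\<close>, then \<open>\<theta>\<close>
  vanishes at \<open>y\<close>, and \<open>y - y r\<close> and \<open>x - x r\<close> agree modulo \<open>p\<^bsup>n+1\<^esup>\<close>.  If \<open>p\<^sup>r\<close> divides \<open>y\<close>, then \<open>x r = p\<^sup>r - 1\<close>, and the jump of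
  \<open>p\<^sup>r\<close> between \<open>x - x r\<close> and \<open>y - y r\<close> is compensated by the \<open>\<xi>\<close>-term at \<open>\<xi> = -1\<close>.
\<close>

lemma chi_tilde_glue:
  assumes p: "p > 1" and y: "y \<in> carrier (padic_int p)"
  shows "chi_tilde p m n 0 (shift p y 1) = chi_tilde p m n (-1) y"
proof -
  have p0: "p > 0" using p by simp
  define r where "r = cutoff m n"
  define x where "x = shift p y 1"
  have x: "x \<in> carrier (padic_int p)"
    unfolding x_def by (rule shift_closed[OF p0 y])
  have xj: "x j = (y j - 1) mod int p ^ j" for j
    unfolding x_def by (rule shift_residue[OF p0 y])
  \<comment> \<open>The carry \<open>t\<close> contributes a full turn and is lost in \<open>cis\<close>.\<close>
  define t where "t = (y (Suc n) - 1) div int p ^ Suc n"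
  have "y (Suc n) - 1 = x (Suc n) + int p ^ Suc n * t"
    unfolding xj t_def by (rule mod_mult_div_eq[symmetric])
  hence "real_of_int (y (Suc n) - 1) = real_of_int (x (Suc n) + int p ^ Suc n * t)" by (rule arg_cong)
  hence t: "real_of_int (y (Suc n)) - 1 = real_of_int (x (Suc n)) + real p ^ Suc n * real_of_int t"
    by (simp del: power_Suc)
  have yr: "0 \<le> y r" "y r < int p ^ r" using y by (auto simp: padic_carrier_iff)
  have "- (if y r = 0 then real p ^ r else 0) + real_of_int (y (Suc n) - y r) =
      real_of_int (x (Suc n) - x r) + real p ^ Suc n * real_of_int t"
  proof (cases "y r = 0")
    case True
    have "x r = (- 1 + int p ^ r) mod int p ^ r" by (simp add: xj True)
    also have "\<dots> = int p ^ r - 1" using p0 by (subst mod_pos_pos_trivial) auto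
    finally show ?thesis using True t by simp
  next
    case False
    hence "x r = y r - 1" using yr by (simp add: xj)
    thus ?thesis using False t by simp
  qed
  hence "(- 1 * (if y r = 0 then real p ^ r else 0) + real_of_int (y (Suc n) - y r)) / real p ^ Suc n =
      (0 * (if x r = 0 then real p ^ r else 0) + real_of_int (x (Suc n) - x r)) / real p ^ Suc n
        + real_of_int t"
    using p0 by (simp add: add_divide_distrib)
  thus ?thesis
    unfolding chi_tilde_eq[OF p y] chi_tilde_eq[OF p x] x_def[symmetric] r_def[symmetric]
    by (simp only: cis_2pi_add_int)
qed



section \<open>The distance on the circle\<close>

text \<open>Jordan's inequality: the concave function \<open>sin\<close> lies above its chord on \<open>[0, \<pi>/2]\<close>.\<close>

lemma Jordan_inequality:
  assumes "0 \<le> t" "t \<le> 1 / 2"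
  shows "2 * t \<le> sin (pi * t)"
proof -
  have cvx: "convex_on {0..pi} (\<lambda>x. - sin x)"
    by (rule f''_ge0_imp_convex[where f' = "\<lambda>x. - cos x" and f'' = sin])
      (auto intro!: derivative_eq_intros sin_ge_zero)
  have "- sin ((1 - 2 * t) *\<^sub>R 0 + (2 * t) *\<^sub>R (pi / 2)) \<le> (1 - 2 * t) * - sin 0 + (2 * t) * - sin (pi / 2)"
    by (rule convex_onD[OF cvx]) (use assms in auto)
  thus ?thesis by (simp add: mult.commute)
qed

lemma circle_dist_le:
  "circle_dist (cis (2 * pi * \<xi>)) (cis (2 * pi * \<eta>)) \<le> \<bar>\<xi> - (\<eta> + real_of_int j)\<bar>"
  unfolding circle_dist_cis
  by (rule cINF_lower2[of _ _ "- j"]) (auto intro!: bdd_belowI[of _ 0])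

lemma circle_dist_attained:
  obtains j :: int
  where "circle_dist (cis (2 * pi * \<xi>)) (cis (2 * pi * \<eta>)) = \<bar>\<xi> - (\<eta> + real_of_int j)\<bar>"
    and "\<bar>\<xi> - (\<eta> + real_of_int j)\<bar> \<le> 1 / 2"
proof
  define j where "j = round (\<xi> - \<eta>)"
  have "\<bar>\<xi> - (\<eta> + real_of_int j)\<bar> \<le> circle_dist (cis (2 * pi * \<xi>)) (cis (2 * pi * \<eta>))"
    unfolding circle_dist_cis
  proof (rule cINF_greatest)
    fix n :: int
    show "\<bar>\<xi> - (\<eta> + real_of_int j)\<bar> \<le> \<bar>\<xi> - \<eta> + real_of_int n\<bar>"
      using round_diff_minimal[of "\<xi> - \<eta>" "- n"] by (simp add: j_def algebra_simps)
  qed simp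
  thus "circle_dist (cis (2 * pi * \<xi>)) (cis (2 * pi * \<eta>)) = \<bar>\<xi> - (\<eta> + real_of_int j)\<bar>"
    using circle_dist_le by (intro antisym)
  show "\<bar>\<xi> - (\<eta> + real_of_int j)\<bar> \<le> 1 / 2"
    using of_int_round_abs_le[of "\<xi> - \<eta>"] by (simp add: j_def abs_minus_commute algebra_simps)
qed

text \<open>
  The chord between two points at circle distance \<open>t \<le> 1/2\<close> has length \<open>2 sin (\<pi> t)\<close>, which lies between
  \<open>4 t\<close> and \<open>2 \<pi> t\<close>.
\<close>

lemma circle_dist_chord:
  assumes "u \<in> sphere 0 1" "v \<in> sphere 0 1"
  shows "0 \<le> circle_dist u v" "4 * circle_dist u v \<le> cmod (u - v)" "cmod (u - v) \<le> 2 * pi * circle_dist u v"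
proof -
  have "z = cis (2 * pi * (Arg z / (2 * pi)))" if "z \<in> sphere 0 1" for z
  proof -
    have "z \<noteq> 0" using that by auto
    thus ?thesis using that cis_Arg[of z] by (simp add: sgn_div_norm)
  qed
  then obtain \<xi> \<eta> where u: "u = cis (2 * pi * \<xi>)" and v: "v = cis (2 * pi * \<eta>)"
    using assms by meson
  obtain j where j: "circle_dist u v = \<bar>\<xi> - (\<eta> + real_of_int j)\<bar>"
      "\<bar>\<xi> - (\<eta> + real_of_int j)\<bar> \<le> 1 / 2"
    unfolding u v by (rule circle_dist_attained)
  define t where "t = \<xi> - (\<eta> + real_of_int j)"
  have "cmod (u - v) = cmod (cis (2 * pi * \<xi>) - cis (2 * pi * (\<eta> + real_of_int j)))"
    unfolding u v by (simp only: cis_2pi_add_int)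
  also have "\<dots> = 2 * \<bar>sin (pi * t)\<bar>"
    by (simp add: norm_cis_diff t_def flip: right_diff_distrib)
  finally have chord: "cmod (u - v) = 2 * \<bar>sin (pi * t)\<bar>" .
  have "\<bar>sin (pi * t)\<bar> = \<bar>sin (pi * \<bar>t\<bar>)\<bar>" by (simp add: abs_if)
  hence "2 * \<bar>t\<bar> \<le> \<bar>sin (pi * t)\<bar>"
    using Jordan_inequality[of "\<bar>t\<bar>"] j(2) by (simp add: t_def)
  thus "4 * circle_dist u v \<le> cmod (u - v)"
    unfolding chord j(1) t_def[symmetric] by simp
  show "cmod (u - v) \<le> 2 * pi * circle_dist u v"
    unfolding chord j(1) t_def[symmetric] using abs_sin_x_le_abs_x[of "pi * t"] by (simp add: abs_mult)
  show "0 \<le> circle_dist u v" by (simp add: j(1))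
qed


section \<open>The map \<open>sigma\<close>\<close>

text \<open>
  Pythagoras, with the \<open>x\<^sub>1 x\<^sub>3\<close>-plane identified with the complex numbers: there the image of \<open>(u, z)\<close> is
  \<open>R u\<close>.
\<close>

lemma dist_sigma:
  fixes a z z' u v :: complex
  defines "R \<equiv> cmod a * (1 + Re (z / a))" and "R' \<equiv> cmod a * (1 + Re (z' / a))"
  shows "dist (sigma a (u, z)) (sigma a (v, z')) =
    sqrt ((cmod (of_real R * u - of_real R' * v))\<^sup>2 + (cmod a * Im ((z - z') / a))\<^sup>2)"
  unfolding dist_norm norm_vec_def L2_set_def sum_3
  by (simp add: sigma_def Let_def cmod_power2 R_def R'_def diff_divide_distrib algebra_simps)

lemma abs_Re_Im_scaled:
  assumes "a \<noteq> 0"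
  shows "cmod a * \<bar>Re (z / a)\<bar> \<le> cmod z" "cmod a * \<bar>Im (z / a)\<bar> \<le> cmod z"
    "cmod z \<le> cmod a * \<bar>Re (z / a)\<bar> + cmod a * \<bar>Im (z / a)\<bar>"
proof -
  have eq: "cmod z = cmod a * cmod (z / a)" using assms by (simp add: norm_divide)
  show "cmod a * \<bar>Re (z / a)\<bar> \<le> cmod z" "cmod a * \<bar>Im (z / a)\<bar> \<le> cmod z"
    unfolding eq by (intro mult_left_mono abs_Re_le_cmod abs_Im_le_cmod norm_ge_zero)+
  show "cmod z \<le> cmod a * \<bar>Re (z / a)\<bar> + cmod a * \<bar>Im (z / a)\<bar>"
    unfolding eq distrib_left[symmetric] by (intro mult_left_mono cmod_le norm_ge_zero)
qed

text \<open>
  Points of the plane in polar coordinates: changing the angle at radius \<open>R\<close> and then the radius by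
  \<open>R - R'\<close>, the three distances involved satisfy the triangle inequality.
\<close>

lemma norm_scaled_diff:
  fixes u v :: complex and R R' :: real
  assumes "cmod v = 1"
  shows "cmod (of_real R * u - of_real R' * v) \<le> \<bar>R\<bar> * cmod (u - v) + \<bar>R - R'\<bar>"
    and "\<bar>R\<bar> * cmod (u - v) \<le> cmod (of_real R * u - of_real R' * v) + \<bar>R - R'\<bar>"
proof -
  have 1: "of_real R * u - of_real R' * v = of_real R * (u - v) + of_real (R - R') * v"
    by (simp add: algebra_simps)
  have 2: "of_real R * (u - v) = (of_real R * u - of_real R' * v) + of_real (R' - R) * v"
    by (simp add: algebra_simps)
  have nR: "cmod (of_real (R - R') * v) = \<bar>R - R'\<bar>" "cmod (of_real (R' - R) * v) = \<bar>R - R'\<bar>"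
    "cmod (of_real R * (u - v)) = \<bar>R\<bar> * cmod (u - v)"
    using assms by (simp_all only: norm_mult norm_of_real mult_1_right abs_minus_commute)
  show "cmod (of_real R * u - of_real R' * v) \<le> \<bar>R\<bar> * cmod (u - v) + \<bar>R - R'\<bar>"
    using norm_triangle_ineq[of "of_real R * (u - v)" "of_real (R - R') * v"]
    unfolding 1[symmetric] nR .
  show "\<bar>R\<bar> * cmod (u - v) \<le> cmod (of_real R * u - of_real R' * v) + \<bar>R - R'\<bar>"
    using norm_triangle_ineq[of "of_real R * u - of_real R' * v" "of_real (R' - R) * v"]
    unfolding 2[symmetric] nR .
qed

lemma sigma_contraction:
  assumes a: "a \<noteq> 0" and "0 \<le> M"
  shows "L_contraction (sphere 0 1 \<times> cball 0 M) d_circle UNIV dist (sigma a)"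
  unfolding L_contraction_def
proof (intro conjI exI[of _ "(cmod a + M) * (2 * pi) + 2"] ballI)
  fix g h :: "complex \<times> complex"
  assume "g \<in> sphere 0 1 \<times> cball 0 M" "h \<in> sphere 0 1 \<times> cball 0 M"
  then obtain u z v z' where g: "g = (u, z)" and h: "h = (v, z')"
    and u: "u \<in> sphere 0 1" and v: "v \<in> sphere 0 1" and z: "cmod z \<le> M"
    by auto
  define R R' where "R = cmod a * (1 + Re (z / a))" and "R' = cmod a * (1 + Re (z' / a))"
  define d where "d = d_circle g h"
  have d: "circle_dist u v \<le> d" "cmod (z - z') \<le> d" "0 \<le> d"
    by (auto simp: d_def d_circle_def g h le_max_iff_disj)
  have "\<bar>R\<bar> \<le> cmod a * 1 + cmod a * \<bar>Re (z / a)\<bar>"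
    unfolding R_def abs_mult distrib_left[symmetric] by (intro mult_mono) auto
  hence R: "\<bar>R\<bar> \<le> cmod a + M" using abs_Re_Im_scaled(1)[OF a, of z] z by simp
  have "\<bar>R - R'\<bar> = cmod a * \<bar>Re ((z - z') / a)\<bar>"
    by (simp add: R_def R'_def diff_divide_distrib abs_mult flip: right_diff_distrib)
  hence RR: "\<bar>R - R'\<bar> \<le> d" using abs_Re_Im_scaled(1)[OF a, of "z - z'"] d by simp
  have "cmod (u - v) \<le> 2 * pi * d"
    by (rule order_trans[OF circle_dist_chord(3)[OF u v]]) (use d in simp)
  hence "\<bar>R\<bar> * cmod (u - v) \<le> (cmod a + M) * (2 * pi * d)"
    using R by (intro mult_mono) (auto intro: order_trans[OF abs_ge_zero])
  hence "cmod (of_real R * u - of_real R' * v) \<le> (cmod a + M) * (2 * pi * d) + d"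
    using norm_scaled_diff(1)[of v R u R'] v RR by simp
  moreover have "\<bar>cmod a * Im ((z - z') / a)\<bar> \<le> d"
    using abs_Re_Im_scaled(2)[OF a, of "z - z'"] d by (simp add: abs_mult)
  moreover have "dist (sigma a g) (sigma a h) \<le>
      \<bar>cmod (of_real R * u - of_real R' * v)\<bar> + \<bar>cmod a * Im ((z - z') / a)\<bar>"
    unfolding g h dist_sigma R_def R'_def by (rule sqrt_sum_squares_le_sum_abs)
  ultimately show "dist (sigma a g) (sigma a h) \<le> ((cmod a + M) * (2 * pi) + 2) * d_circle g h"
    unfolding d_def[symmetric] by (simp add: algebra_simps)
qed (use assms in \<open>auto intro!: add_nonneg_pos\<close>)

text \<open>
  As long as both radii are positive, the distance of the images bounds the difference \<open>R - R'\<close> of the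
  radii, which is \<open>\<bar>a\<bar>\<close> times the difference of \<open>Re (z/a)\<close>.  What remains is an angular displacement at radius
  \<open>R \<ge> \<bar>a\<bar> \<delta>\<close>, so \<open>u\<close> and \<open>v\<close> are close as well.
\<close>

lemma sigma_expansive:
  assumes a: "a \<noteq> 0" and "0 < \<delta>"
    and u: "u \<in> sphere 0 1" and v: "v \<in> sphere 0 1"
    and z: "\<delta> \<le> 1 + Re (z / a)" and z': "\<delta> \<le> 1 + Re (z' / a)"
  shows "d_circle (u, z) (v, z') \<le> (2 + 1 / (cmod a * \<delta>)) * dist (sigma a (u, z)) (sigma a (v, z'))"
proof -
  define R R' where "R = cmod a * (1 + Re (z / a))" and "R' = cmod a * (1 + Re (z' / a))"
  define e where "e = dist (sigma a (u, z)) (sigma a (v, z'))"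
  have e: "cmod (of_real R * u - of_real R' * v) \<le> e" "cmod a * \<bar>Im ((z - z') / a)\<bar> \<le> e" "0 \<le> e"
  proof -
    have "\<bar>cmod a * Im ((z - z') / a)\<bar> \<le> e"
      unfolding e_def dist_sigma real_sqrt_abs[symmetric] by (intro real_sqrt_le_mono) simp
    thus "cmod a * \<bar>Im ((z - z') / a)\<bar> \<le> e" by (simp add: abs_mult)
    show "cmod (of_real R * u - of_real R' * v) \<le> e"
      unfolding e_def dist_sigma R_def R'_def by (rule real_le_rsqrt) simp
  qed (simp add: e_def)
  have pos: "0 < cmod a * \<delta>" using assms by simp
  have R: "cmod a * \<delta> \<le> R" "cmod a * \<delta> \<le> R'"
    unfolding R_def R'_def using z z' by (auto intro: mult_left_mono)
  have "\<bar>R - R'\<bar> = \<bar>cmod (of_real R * u) - cmod (of_real R' * v)\<bar>"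
    using R pos u v by (simp add: norm_mult)
  hence RR: "\<bar>R - R'\<bar> \<le> e"
    using norm_triangle_ineq3[of "of_real R * u" "of_real R' * v"] e(1) by linarith
  have "cmod a * \<delta> * (4 * circle_dist u v) \<le> \<bar>R\<bar> * cmod (u - v)"
    using R pos circle_dist_chord[OF u v] by (intro mult_mono) auto
  also have "\<dots> \<le> 2 * e"
    using norm_scaled_diff(2)[of v R u R'] v RR e(1) by simp
  finally have "cmod a * \<delta> * circle_dist u v \<le> 1 * e"
    using e(3) by (simp add: mult_ac)
  hence "circle_dist u v \<le> 1 / (cmod a * \<delta>) * e"
    using pos by (simp add: field_simps)
  moreover have "cmod (z - z') \<le> 2 * e"
  proof -
    have "cmod a * \<bar>Re ((z - z') / a)\<bar> = \<bar>R - R'\<bar>"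
      by (simp add: R_def R'_def diff_divide_distrib abs_mult flip: right_diff_distrib)
    thus ?thesis using abs_Re_Im_scaled(3)[OF a, of "z - z'"] e(2) RR by linarith
  qed
  moreover have "0 \<le> 1 / (cmod a * \<delta>) * e" using pos e(3) by simp
  ultimately show ?thesis
    unfolding e_def[symmetric] d_circle_def prod.case distrib_right using e(3) by simp
qed


section \<open>Composition of L-contractions and L-isometries\<close>

text \<open>
  The second map has to be controlled only on a set \<open>N'\<close> that contains the image of the first one: \<open>sigma\<close> is
  Lipschitz only for bounded \<open>z\<close>.
\<close>

lemma L_contraction_compose:
  assumes "L_contraction M d N d' \<Phi>" "\<Phi> \<in> M \<rightarrow> N'" "L_contraction N' d' P d'' \<Psi>"
  shows "L_contraction M d P d'' (\<Psi> \<circ> \<Phi>)"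
proof -
  obtain C where C: "C > 0" "\<And>u w. u \<in> M \<Longrightarrow> w \<in> M \<Longrightarrow> d' (\<Phi> u) (\<Phi> w) \<le> C * d u w"
    using assms(1) unfolding L_contraction_def by blast
  obtain C' where C': "C' > 0" "\<And>u w. u \<in> N' \<Longrightarrow> w \<in> N' \<Longrightarrow> d'' (\<Psi> u) (\<Psi> w) \<le> C' * d' u w"
    and map: "\<Psi> \<in> N' \<rightarrow> P"
    using assms(3) unfolding L_contraction_def by blast
  have "d'' (\<Psi> (\<Phi> u)) (\<Psi> (\<Phi> w)) \<le> C' * C * d u w" if "u \<in> M" "w \<in> M" for u w
  proof -
    have "d'' (\<Psi> (\<Phi> u)) (\<Psi> (\<Phi> w)) \<le> C' * d' (\<Phi> u) (\<Phi> w)"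
      using that assms(2) by (intro C'(2)) auto
    also have "\<dots> \<le> C' * (C * d u w)"
      using that C'(1) by (intro mult_left_mono C(2)) auto
    finally show ?thesis by (simp add: mult.assoc)
  qed
  thus ?thesis
    unfolding L_contraction_def comp_def using C(1) C'(1) map assms(2)
    by (intro conjI exI[of _ "C' * C"]) auto
qed

text \<open>
  The lower bound for the second map is required only along the image of the first one.
\<close>

lemma L_isometry_compose:
  assumes iso: "L_isometry M d N d' \<Phi>" and map: "\<Phi> \<in> M \<rightarrow> N'"
    and con: "L_contraction N' d' P d'' \<Psi>"
    and lower: "C' > 0" "\<And>u w. u \<in> M \<Longrightarrow> w \<in> M \<Longrightarrow> d' (\<Phi> u) (\<Phi> w) \<le> C' * d'' (\<Psi> (\<Phi> u)) (\<Psi> (\<Phi> w))"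
  shows "L_isometry M d P d'' (\<Psi> \<circ> \<Phi>)"
proof -
  obtain C where C: "C > 0" "\<And>u w. u \<in> M \<Longrightarrow> w \<in> M \<Longrightarrow> d u w \<le> C * d' (\<Phi> u) (\<Phi> w)"
    using iso unfolding L_isometry_def by blast
  have "d u w \<le> C * C' * d'' (\<Psi> (\<Phi> u)) (\<Psi> (\<Phi> w))" if "u \<in> M" "w \<in> M" for u w
  proof -
    have "d u w \<le> C * d' (\<Phi> u) (\<Phi> w)" by (rule C(2)[OF that])
    also have "\<dots> \<le> C * (C' * d'' (\<Psi> (\<Phi> u)) (\<Psi> (\<Phi> w)))"
      using C(1) by (intro mult_left_mono lower(2)[OF that]) simp
    finally show ?thesis by (simp add: mult.assoc)
  qed
  moreover have "L_contraction M d P d'' (\<Psi> \<circ> \<Phi>)"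
    using L_contraction_compose[OF _ map con] iso unfolding L_isometry_def by blast
  ultimately show ?thesis
    unfolding L_isometry_def comp_def using C(1) lower(1) by (intro conjI exI[of _ "C * C'"]) auto
qed


section \<open>Upper and lower estimates for the series\<close>

locale digit_series =
  fixes p :: nat and m :: enat and s :: complex
  assumes p_gt_1: "p > 1" and s_pos: "0 < cmod s" and s_lt_1: "cmod s < 1"
begin

abbreviation Z :: "(nat \<Rightarrow> int) set" where
  "Z \<equiv> carrier (padic_int p)"

abbreviation \<alpha> :: real where
  "\<alpha> \<equiv> 1 / D_exponent p s"

text \<open>
  The sum of the Lipschitz constants \<open>2 \<pi> \<bar>s\<bar>\<^sup>n\<close> of the terms in the variable \<open>\<xi>\<close>.  It also exceeds \<open>2 / (1 - \<bar>s\<bar>)\<close>,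
  the constant for the variable \<open>x\<close>, and the diameter of the range of the series; using it for all
  three keeps the estimates uniform.
\<close>

definition K :: real where
  "K = 2 * pi / (1 - cmod s)"

lemma p_pos: "p > 0"
  using p_gt_1 by simp

lemma K_pos: "K > 0"
  using s_lt_1 by (simp add: K_def)

lemma geometric: "summable (\<lambda>n. cmod s ^ n)" "(\<Sum>n. cmod s ^ n) = 1 / (1 - cmod s)"
  using s_lt_1 by (simp_all add: summable_geometric suminf_geometric)

lemma omega_summable: "summable (\<lambda>n. s ^ n * chi_tilde p m n \<xi> x)"
  by (rule summable_comparison_test[OF _ geometric(1)]) (simp add: norm_mult norm_power norm_chi_tilde)

text \<open>
  If the first \<open>N\<close> terms agree, the difference is the tail of a geometric series.  With \<open>N = 0\<close>
  it transfers bounds on all terms to the sum; with \<open>N = v(x-y)\<close> and \<open>c = 2\<close> it bounds the variation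
  along a fibre.
\<close>

lemma norm_omega_diff_le:
  assumes "\<And>n. cmod (chi_tilde p m n \<xi> x - chi_tilde p m n \<eta> y) \<le> c"
    and "\<And>n. n < N \<Longrightarrow> chi_tilde p m n \<xi> x = chi_tilde p m n \<eta> y"
  shows "cmod (omega p m s \<xi> x - omega p m s \<eta> y) \<le> c * cmod s ^ N / (1 - cmod s)"
proof -
  define f where "f n = s ^ n * (chi_tilde p m n \<xi> x - chi_tilde p m n \<eta> y)" for n
  have f: "summable f"
    using summable_diff[OF omega_summable[of \<xi> x] omega_summable[of \<eta> y]]
    by (simp add: f_def[abs_def] algebra_simps)
  have le: "cmod (f (n + N)) \<le> c * cmod s ^ N * cmod s ^ n" for n
    using mult_left_mono[OF assms(1)[of "n + N"], of "cmod s ^ (n + N)"]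
    by (simp add: f_def norm_mult norm_power power_add mult_ac)
  have "omega p m s \<xi> x - omega p m s \<eta> y = (\<Sum>n. f n)"
    unfolding omega_def suminf_diff[OF omega_summable omega_summable]
    by (simp add: f_def algebra_simps)
  also have "\<dots> = (\<Sum>n. f (n + N)) + (\<Sum>n<N. f n)"
    by (rule suminf_split_initial_segment[OF f])
  also have "(\<Sum>n<N. f n) = 0"
    using assms(2) by (simp add: f_def)
  finally have "cmod (omega p m s \<xi> x - omega p m s \<eta> y) = cmod (\<Sum>n. f (n + N))"
    by simp
  also have "\<dots> \<le> (\<Sum>n. c * cmod s ^ N * cmod s ^ n)"
    by (rule norm_suminf_le[OF le summable_mult[OF geometric(1)]])
  also have "\<dots> = c * cmod s ^ N / (1 - cmod s)"
    by (simp add: suminf_mult[OF geometric(1)] geometric(2))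
  finally show ?thesis .
qed

lemma norm_chi_tilde_diff: "cmod (chi_tilde p m n \<xi> x - chi_tilde p m n \<eta> y) \<le> 2"
  using norm_triangle_ineq4[of "chi_tilde p m n \<xi> x" "chi_tilde p m n \<eta> y"]
  by (simp add: norm_chi_tilde)

lemma norm_omega: "cmod (omega p m s \<xi> x) \<le> 1 / (1 - cmod s)"
proof -
  have "cmod (omega p m s \<xi> x) \<le> (\<Sum>n. cmod s ^ n)"
    unfolding omega_def
    by (rule norm_suminf_le[OF _ geometric(1)]) (simp add: norm_mult norm_power norm_chi_tilde)
  thus ?thesis by (simp add: geometric(2))
qed

lemma tail_const_le_K: "2 * c / (1 - cmod s) \<le> K * c" if "0 \<le> c"
proof -
  have "2 * c \<le> (2 * pi) * c" using pi_ge_two that by (intro mult_right_mono) auto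
  thus ?thesis unfolding K_def using s_lt_1 by (simp add: divide_right_mono)
qed

lemma omega_diff_bounded: "cmod (omega p m s \<xi> x - omega p m s \<eta> y) \<le> K"
  using norm_omega_diff_le[of \<xi> x \<eta> y 2 0, OF norm_chi_tilde_diff] tail_const_le_K[of 1] by simp

lemma omega_Lipschitz:
  assumes x: "x \<in> Z" and y: "y \<in> Z"
  shows "cmod (omega p m s \<xi> x - omega p m s \<eta> y) \<le> K * (\<bar>\<xi> - \<eta>\<bar> + sdist s x y)"
proof -
  have "cmod (omega p m s \<xi> x - omega p m s \<eta> x) \<le> K * \<bar>\<xi> - \<eta>\<bar>"
    using norm_omega_diff_le[of \<xi> x \<eta> x "2 * pi * \<bar>\<xi> - \<eta>\<bar>" 0, OF chi_tilde_Lipschitz[OF p_gt_1]]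
    by (simp add: K_def)
  moreover have "cmod (omega p m s \<eta> x - omega p m s \<eta> y) \<le> K * sdist s x y"
  proof (cases "x = y")
    case False
    define N where "N = (LEAST n. x (Suc n) \<noteq> y (Suc n))"
    have "chi_tilde p m n \<eta> x = chi_tilde p m n \<eta> y" if "n < N" for n
      using not_less_Least[OF that[unfolded N_def]] by (intro chi_tilde_cong[OF p_gt_1 x y]) simp
    from norm_omega_diff_le[OF norm_chi_tilde_diff this]
    have "cmod (omega p m s \<eta> x - omega p m s \<eta> y) \<le> 2 * cmod s ^ N / (1 - cmod s)" .
    also have "\<dots> \<le> K * cmod s ^ N" by (rule tail_const_le_K) simp
    finally show ?thesis using False by (simp add: sdist_def N_def)
  qed (simp add: sdist_def)
  moreover have "cmod (omega p m s \<xi> x - omega p m s \<eta> y) \<le>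
      cmod (omega p m s \<xi> x - omega p m s \<eta> x) + cmod (omega p m s \<eta> x - omega p m s \<eta> y)"
    by (rule order_trans[OF _ norm_triangle_ineq]) simp
  ultimately show ?thesis by (simp add: distrib_left)
qed

lemma omega_glue:
  assumes "y \<in> Z"
  shows "omega p m s 0 (shift p y 1) = omega p m s (-1) y"
  by (simp add: omega_def chi_tilde_glue[OF p_gt_1 assms])

lemma Delta_tilde_le:
  assumes x: "x \<in> Z" and y: "y \<in> Z"
  shows "Delta_tilde p m s * sdist s x y \<le> cmod (omega p m s \<xi> x - omega p m s \<xi> y)"
proof (cases "x = y")
  case False
  define v where "v = padic_val (x \<ominus>\<^bsub>padic_int p\<^esub> y)"
  have "Delta_tilde p m s \<le> cmod (s powi (- int v) * (omega p m s \<xi> x - omega p m s \<xi> y))"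
    unfolding Delta_tilde_def
    by (rule cINF_lower2[of _ _ "(x, y, \<xi>)"])
      (use x y False in \<open>auto simp: v_def intro!: bdd_belowI[of _ 0]\<close>)
  also have "\<dots> = cmod (omega p m s \<xi> x - omega p m s \<xi> y) / cmod s ^ v"
    by (simp add: norm_mult power_int_minus norm_inverse norm_power divide_inverse mult.commute)
  finally show ?thesis
    using s_pos by (simp add: sdist_eq_power_val[OF p_pos x y False] v_def pos_le_divide_eq)
qed (simp add: sdist_def)

text \<open>
  Move \<open>(\<eta>, y)\<close> into the fibre over \<open>\<xi>\<close>, where \<open>Delta_tilde\<close> gives the lower bound; the move costs at most
  \<open>K \<bar>\<xi> - \<eta>\<bar>\<close>.
\<close>

lemma omega_expansive:
  assumes x: "x \<in> Z" and y: "y \<in> Z"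
  shows "Delta_tilde p m s * sdist s x y \<le>
    cmod (omega p m s \<xi> x - omega p m s \<eta> y) + K * \<bar>\<xi> - \<eta>\<bar>"
proof -
  have "cmod (omega p m s \<xi> x - omega p m s \<xi> y) \<le>
      cmod (omega p m s \<xi> x - omega p m s \<eta> y) + cmod (omega p m s \<eta> y - omega p m s \<xi> y)"
    by (rule order_trans[OF _ norm_triangle_ineq]) simp
  also have "cmod (omega p m s \<eta> y - omega p m s \<xi> y) \<le> K * \<bar>\<xi> - \<eta>\<bar>"
    using omega_Lipschitz[OF y y, of \<eta> \<xi>] by (simp add: sdist_def abs_minus_commute)
  finally show ?thesis using Delta_tilde_le[OF x y, of \<xi>] by linarith
qed

text \<open>
  The point \<open>(\<eta>, y)\<close> is compared with \<open>(\<xi>, x)\<close> through its translate \<open>(\<eta> + 1, y - 1)\<close>, which lies beyond the upper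
  end of the strip.  For finite \<open>m\<close> the values of \<open>\<omega>\<close> outside the strip say nothing about the quotient map, so one
  goes from \<open>\<xi>\<close> up to \<open>0\<close> with second coordinates \<open>x\<close> and \<open>y - 1\<close>, passes to \<open>(-1, y)\<close> by \<open>omega_glue\<close>, and goes from
  there up to \<open>\<eta>\<close>.  As \<open>\<xi> \<le> 0 \<le> \<eta> + 1\<close>, the lengths of the two pieces add up to \<open>\<bar>\<xi> - (\<eta> + 1)\<bar>\<close>.
\<close>

lemma omega_across:
  assumes x: "x \<in> Z" and y: "y \<in> Z" and "\<xi> \<le> 0" "-1 \<le> \<eta>"
  shows "cmod (omega p m s \<xi> x - omega p m s \<eta> y) \<le> K * (\<bar>\<xi> - (\<eta> + 1)\<bar> + sdist s x (shift p y 1))"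
    and "Delta_tilde p m s * sdist s x (shift p y 1) \<le>
      cmod (omega p m s \<xi> x - omega p m s \<eta> y) + K * \<bar>\<xi> - (\<eta> + 1)\<bar>"
proof -
  let ?y = "shift p y 1"
  have y': "?y \<in> Z" by (rule shift_closed[OF p_pos y])
  have tail: "cmod (omega p m s 0 ?y - omega p m s \<eta> y) \<le> K * (\<eta> + 1)"
  proof -
    have "\<bar>-1 - \<eta>\<bar> = \<eta> + 1" using assms(4) by simp
    thus ?thesis using omega_Lipschitz[OF y y, of "-1" \<eta>] by (simp add: omega_glue[OF y] sdist_def)
  qed
  have split: "K * \<bar>\<xi> - (\<eta> + 1)\<bar> = K * \<bar>\<xi> - 0\<bar> + K * (\<eta> + 1)"
  proof -
    have "\<bar>\<xi> - (\<eta> + 1)\<bar> = \<bar>\<xi> - 0\<bar> + (\<eta> + 1)" using assms(3,4) by simp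
    thus ?thesis by (simp only: distrib_left)
  qed
  have "cmod (omega p m s \<xi> x - omega p m s \<eta> y) \<le>
      cmod (omega p m s \<xi> x - omega p m s 0 ?y) + cmod (omega p m s 0 ?y - omega p m s \<eta> y)"
    by (rule order_trans[OF _ norm_triangle_ineq]) simp
  thus "cmod (omega p m s \<xi> x - omega p m s \<eta> y) \<le> K * (\<bar>\<xi> - (\<eta> + 1)\<bar> + sdist s x ?y)"
    using omega_Lipschitz[OF x y', of \<xi> 0] tail unfolding distrib_left split by linarith
  have "cmod (omega p m s \<xi> x - omega p m s 0 ?y) \<le>
      cmod (omega p m s \<xi> x - omega p m s \<eta> y) + cmod (omega p m s \<eta> y - omega p m s 0 ?y)"
    by (rule order_trans[OF _ norm_triangle_ineq]) simp
  thus "Delta_tilde p m s * sdist s x ?y \<le>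
      cmod (omega p m s \<xi> x - omega p m s \<eta> y) + K * \<bar>\<xi> - (\<eta> + 1)\<bar>"
    using omega_expansive[OF x y', of \<xi> 0] tail unfolding split
    by (simp only: norm_minus_commute[of "omega p m s 0 ?y"])
qed

lemma sdist_shift_swap:
  assumes "x \<in> Z" "y \<in> Z"
  shows "sdist s y (shift p x (- j)) = sdist s x (shift p y j)"
proof -
  have "sdist s x (shift p y j) = sdist s (shift p x (- j)) (shift p y 0)"
    using sdist_shift[OF p_pos assms, of s "- j" 0] by simp
  thus ?thesis using shift_0[OF p_pos assms(2)] by (simp add: sdist_commute)
qed

text \<open>
  The Lipschitz bound against every translate of the second point.  The case \<open>j = -1\<close> is the case
  \<open>j = 1\<close> with the two points exchanged; for \<open>\<bar>j\<bar> \<ge> 2\<close> the first coordinates differ by more than \<open>1\<close>.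
\<close>

lemma omega_strip_Lipschitz:
  assumes x: "x \<in> Z" and y: "y \<in> Z" and \<xi>: "\<xi> \<in> {-1<..0}" and \<eta>: "\<eta> \<in> {-1<..0}"
  shows "cmod (omega p m s \<xi> x - omega p m s \<eta> y) \<le>
    K * (\<bar>\<xi> - (\<eta> + real_of_int j)\<bar> + sdist s x (shift p y j))"
proof -
  consider "j = 0" | "j = 1" | "j = -1" | "j \<le> -2 \<or> 2 \<le> j" by linarith
  thus ?thesis
  proof cases
    case 1
    thus ?thesis using omega_Lipschitz[OF x y] by (simp add: shift_0[OF p_pos y])
  next
    case 2
    thus ?thesis using omega_across(1)[OF x y, of \<xi> \<eta>] \<xi> \<eta> by simp
  next
    case 3
    thus ?thesis
      using omega_across(1)[OF y x, of \<eta> \<xi>] \<xi> \<eta> sdist_shift_swap[OF x y, of "-1"]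
      by (simp add: norm_minus_commute abs_minus_commute algebra_simps)
  next
    case 4
    hence "real_of_int j \<le> -2 \<or> 2 \<le> real_of_int j" by linarith
    hence "1 \<le> \<bar>\<xi> - (\<eta> + real_of_int j)\<bar>" using \<xi> \<eta> by auto
    hence "K * 1 \<le> K * (\<bar>\<xi> - (\<eta> + real_of_int j)\<bar> + sdist s x (shift p y j))"
      using K_pos sdist_nonneg[of s x "shift p y j"] by (intro mult_left_mono) auto
    thus ?thesis using omega_diff_bounded[of \<xi> x \<eta> y] by linarith
  qed
qed

text \<open>
  The restriction on \<open>j\<close> is harmless, since two points of the strip are closest on the circle for
  some \<open>\<bar>j\<bar> \<le> 1\<close>.
\<close>

lemma omega_strip_expansive:
  assumes x: "x \<in> Z" and y: "y \<in> Z" and \<xi>: "\<xi> \<in> {-1<..0}" and \<eta>: "\<eta> \<in> {-1<..0}"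
    and j: "\<bar>j\<bar> \<le> 1"
  shows "Delta_tilde p m s * sdist s x (shift p y j) \<le>
    cmod (omega p m s \<xi> x - omega p m s \<eta> y) + K * \<bar>\<xi> - (\<eta> + real_of_int j)\<bar>"
proof -
  consider "j = 0" | "j = 1" | "j = -1" using j by linarith
  thus ?thesis
  proof cases
    case 1
    thus ?thesis using omega_expansive[OF x y] by (simp add: shift_0[OF p_pos y])
  next
    case 2
    thus ?thesis using omega_across(2)[OF x y, of \<xi> \<eta>] \<xi> \<eta> by simp
  next
    case 3
    thus ?thesis
      using omega_across(2)[OF y x, of \<eta> \<xi>] \<xi> \<eta> sdist_shift_swap[OF x y, of "-1"]
      by (simp add: norm_minus_commute abs_minus_commute algebra_simps)
  qed
qed


section \<open>The three maps\<close>

lemma phi_shift: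
  assumes "x \<in> Z"
  shows "phi p (\<xi> + real_of_int k, shift p x k) = phi p (\<xi>, x)"
proof -
  have "{(\<xi> + real_of_int k + real_of_int l, shift p x (k + l)) | l. True} =
      {(\<xi> + real_of_int l, shift p x l) | l. True}" (is "?A = ?B")
  proof
    show "?A \<subseteq> ?B"
    proof
      fix u assume "u \<in> ?A"
      then obtain l where "u = (\<xi> + real_of_int (k + l), shift p x (k + l))" by auto
      thus "u \<in> ?B" by blast
    qed
    show "?B \<subseteq> ?A"
    proof
      fix u assume "u \<in> ?B"
      then obtain l where "u = (\<xi> + real_of_int l, shift p x l)" by auto
      hence "u = (\<xi> + real_of_int k + real_of_int (l - k), shift p x (k + (l - k)))" by simp
      thus "u \<in> ?A" by blast
    qed
  qed
  thus ?thesis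
    using assms by (simp add: phi_eq p_pos shift_closed shift_shift)
qed

lemma solenoid_strip:
  assumes "f \<in> solenoid p"
  obtains \<xi> x where "\<xi> \<in> {-1<..0}" "x \<in> Z" "f = phi p (\<xi>, x)"
proof -
  obtain \<xi> x where x: "x \<in> Z" and f: "f = phi p (\<xi>, x)"
    using assms mem_solenoid_iff by blast
  have "\<xi> + real_of_int (- \<lceil>\<xi>\<rceil>) \<in> {-1<..0}" by simp linarith
  moreover have "f = phi p (\<xi> + real_of_int (- \<lceil>\<xi>\<rceil>), shift p x (- \<lceil>\<xi>\<rceil>))"
    unfolding f by (rule phi_shift[OF x, symmetric])
  ultimately show thesis using that shift_closed[OF p_pos x] by blast
qed

lemma mho_strip:
  assumes \<xi>: "\<xi> \<in> {-1<..0}" and x: "x \<in> Z"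
  shows "mho p m s (phi p (\<xi>, x)) = (cis (2 * pi * \<xi>), omega p m s \<xi> x)"
proof -
  have "phi p (\<xi>, x) \<in> solenoid p" using x mem_solenoid_iff by blast
  note ex1 = strip_representative[OF p_pos this]
  have "(\<xi>, x) \<in> phi p (\<xi>, x)"
    unfolding phi_eq[OF p_pos x] using shift_0[OF p_pos x] by (auto intro!: exI[of _ 0])
  hence "(THE u. u \<in> phi p (\<xi>, x) \<and> fst u \<in> {-1<..0}) = (\<xi>, x)"
    using \<xi> by (intro the1_equality[OF ex1]) simp
  thus ?thesis by (simp add: mho_def)
qed

lemma rho_hat_eq:
  assumes "x \<in> Z" "y \<in> Z"
  shows "rho_hat p \<alpha> (\<xi>, x) (\<eta>, y) = max \<bar>\<xi> - \<eta>\<bar> (sdist s x y)"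
  by (simp add: rho_hat_def padic_abs_powr_eq_sdist[OF p_gt_1 s_pos s_lt_1 assms])

text \<open>
  The metric on the cover is invariant under translating both points by the same element of \<open>B\<close>, so
  the infimum over both cosets reduces to one over the relative translation.
\<close>

lemma rho_phi:
  assumes x: "x \<in> Z" and y: "y \<in> Z"
  shows "rho p \<alpha> (phi p (\<xi>, x)) (phi p (\<eta>, y)) =
    (INF j. max \<bar>\<xi> - (\<eta> + real_of_int j)\<bar> (sdist s x (shift p y j)))"
proof -
  define r where "r j = max \<bar>\<xi> - (\<eta> + real_of_int j)\<bar> (sdist s x (shift p y j))" for j
  have eq: "rho_hat p \<alpha> (\<xi> + real_of_int k, shift p x k) (\<eta> + real_of_int l, shift p y l) = r (l - k)" for k l
    using x y by (simp add: rho_hat_eq shift_closed p_pos r_def sdist_shift[OF p_pos x y] algebra_simps)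
  have "(\<lambda>(u, w). rho_hat p \<alpha> u w) ` (phi p (\<xi>, x) \<times> phi p (\<eta>, y)) = range r"
  proof
    show "(\<lambda>(u, w). rho_hat p \<alpha> u w) ` (phi p (\<xi>, x) \<times> phi p (\<eta>, y)) \<subseteq> range r"
      unfolding phi_eq[OF p_pos x] phi_eq[OF p_pos y] by (auto simp: eq)
    show "range r \<subseteq> (\<lambda>(u, w). rho_hat p \<alpha> u w) ` (phi p (\<xi>, x) \<times> phi p (\<eta>, y))"
    proof
      fix t assume "t \<in> range r"
      then obtain j where "t = r j" by blast
      hence "t = rho_hat p \<alpha> (\<xi> + real_of_int 0, shift p x 0) (\<eta> + real_of_int j, shift p y j)"
        by (simp only: eq) simp
      thus "t \<in> (\<lambda>(u, w). rho_hat p \<alpha> u w) ` (phi p (\<xi>, x) \<times> phi p (\<eta>, y))"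
        unfolding phi_eq[OF p_pos x] phi_eq[OF p_pos y] by blast
    qed
  qed
  thus ?thesis by (simp add: rho_def r_def[abs_def])
qed

lemma otimes_omega_contraction:
  "L_contraction (UNIV \<times> Z) (rho_hat p \<alpha>) UNIV d_hat (otimes_omega p m s)"
  unfolding L_contraction_def
proof (intro conjI exI[of _ "1 + 2 * K"] ballI)
  fix u w :: "real \<times> (nat \<Rightarrow> int)" assume "u \<in> UNIV \<times> Z" "w \<in> UNIV \<times> Z"
  then obtain \<xi> \<eta> :: real and x y where u: "u = (\<xi>, x)" "x \<in> Z" and w: "w = (\<eta>, y)" "y \<in> Z" by auto
  define r where "r = max \<bar>\<xi> - \<eta>\<bar> (sdist s x y)"
  have r: "0 \<le> r" "\<bar>\<xi> - \<eta>\<bar> \<le> r" "sdist s x y \<le> r" by (auto simp: r_def)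
  have "K * (\<bar>\<xi> - \<eta>\<bar> + sdist s x y) \<le> K * (2 * r)"
    using r K_pos by (intro mult_left_mono) auto
  hence "cmod (omega p m s \<xi> x - omega p m s \<eta> y) \<le> K * (2 * r)"
    using omega_Lipschitz[OF u(2) w(2), of \<xi> \<eta>] by linarith
  moreover have "r \<le> (1 + 2 * K) * r" "K * (2 * r) \<le> (1 + 2 * K) * r"
    using r K_pos by (simp_all add: distrib_right)
  ultimately have "max \<bar>\<xi> - \<eta>\<bar> (cmod (omega p m s \<xi> x - omega p m s \<eta> y)) \<le> (1 + 2 * K) * r"
    unfolding max.bounded_iff using r by linarith
  thus "d_hat (otimes_omega p m s u) (otimes_omega p m s w) \<le> (1 + 2 * K) * rho_hat p \<alpha> u w"
    using u w by (simp add: rho_hat_eq d_hat_def otimes_omega_def r_def)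
qed (use K_pos in auto)

lemma otimes_omega_isometry:
  assumes \<Delta>: "Delta_tilde p m s > 0"
  shows "L_isometry (UNIV \<times> Z) (rho_hat p \<alpha>) UNIV d_hat (otimes_omega p m s)"
  unfolding L_isometry_def
proof (intro conjI exI[of _ "1 + (1 + K) / Delta_tilde p m s"] ballI otimes_omega_contraction)
  fix u w :: "real \<times> (nat \<Rightarrow> int)" assume "u \<in> UNIV \<times> Z" "w \<in> UNIV \<times> Z"
  then obtain \<xi> \<eta> :: real and x y where u: "u = (\<xi>, x)" "x \<in> Z" and w: "w = (\<eta>, y)" "y \<in> Z" by auto
  define r where "r = max \<bar>\<xi> - \<eta>\<bar> (cmod (omega p m s \<xi> x - omega p m s \<eta> y))"
  have r: "0 \<le> r" "\<bar>\<xi> - \<eta>\<bar> \<le> r" "cmod (omega p m s \<xi> x - omega p m s \<eta> y) \<le> r" by (auto simp: r_def)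
  have "K * \<bar>\<xi> - \<eta>\<bar> \<le> K * r" using r K_pos by simp
  hence "Delta_tilde p m s * sdist s x y \<le> (1 + K) * r"
    using omega_expansive[OF u(2) w(2), of \<xi> \<eta>] r unfolding distrib_right by linarith
  hence "sdist s x y \<le> (1 + K) / Delta_tilde p m s * r"
    using \<Delta> by (simp add: field_simps)
  moreover have "0 \<le> (1 + K) / Delta_tilde p m s * r" using r K_pos \<Delta> by simp
  ultimately have "max \<bar>\<xi> - \<eta>\<bar> (sdist s x y) \<le> (1 + (1 + K) / Delta_tilde p m s) * r"
    using r by (simp add: distrib_right)
  thus "rho_hat p \<alpha> u w \<le> (1 + (1 + K) / Delta_tilde p m s) * d_hat (otimes_omega p m s u) (otimes_omega p m s w)"
    using u w by (simp add: rho_hat_eq d_hat_def otimes_omega_def r_def)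
qed (use K_pos \<Delta> in \<open>auto intro: add_pos_pos divide_pos_pos\<close>)

lemma mho_range: "mho p m s \<in> solenoid p \<rightarrow> sphere 0 1 \<times> cball 0 (1 / (1 - cmod s))"
proof
  fix f assume "f \<in> solenoid p"
  then obtain \<xi> x where "\<xi> \<in> {-1<..0}" "x \<in> Z" "f = phi p (\<xi>, x)" by (rule solenoid_strip)
  thus "mho p m s f \<in> sphere 0 1 \<times> cball 0 (1 / (1 - cmod s))"
    using norm_omega by (simp add: mho_strip)
qed

lemma mho_contraction:
  "L_contraction (solenoid p) (rho p \<alpha>) (sphere 0 1 \<times> UNIV) d_circle (mho p m s)"
  unfolding L_contraction_def
proof (intro conjI exI[of _ "1 + 2 * K"] ballI)
  show "mho p m s \<in> solenoid p \<rightarrow> sphere 0 1 \<times> UNIV" using mho_range by (auto simp: Pi_iff mem_Times_iff)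
  fix f g assume fg: "f \<in> solenoid p" "g \<in> solenoid p"
  obtain \<xi> x where \<xi>: "\<xi> \<in> {-1<..0}" and x: "x \<in> Z" and f: "f = phi p (\<xi>, x)"
    using fg(1) by (rule solenoid_strip)
  obtain \<eta> y where \<eta>: "\<eta> \<in> {-1<..0}" and y: "y \<in> Z" and g: "g = phi p (\<eta>, y)"
    using fg(2) by (rule solenoid_strip)
  define D where "D = d_circle (mho p m s f) (mho p m s g)"
  \<comment> \<open>The constant is moved to the left so that the estimate survives the infimum over \<open>j\<close>.\<close>
  have "D / (1 + 2 * K) \<le> rho p \<alpha> f g"
    unfolding f g rho_phi[OF x y]
  proof (rule cINF_greatest)
    fix j :: int
    define r where "r = max \<bar>\<xi> - (\<eta> + real_of_int j)\<bar> (sdist s x (shift p y j))"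
    have r: "0 \<le> r" "\<bar>\<xi> - (\<eta> + real_of_int j)\<bar> \<le> r" "sdist s x (shift p y j) \<le> r"
      by (auto simp: r_def)
    have "K * (\<bar>\<xi> - (\<eta> + real_of_int j)\<bar> + sdist s x (shift p y j)) \<le> K * (2 * r)"
      using r K_pos by (intro mult_left_mono) auto
    hence "cmod (omega p m s \<xi> x - omega p m s \<eta> y) \<le> K * (2 * r)"
      using omega_strip_Lipschitz[OF x y \<xi> \<eta>, of j] by linarith
    moreover have "circle_dist (cis (2 * pi * \<xi>)) (cis (2 * pi * \<eta>)) \<le> r"
      using circle_dist_le r(2) by (rule order_trans)
    moreover have "r \<le> (1 + 2 * K) * r" "K * (2 * r) \<le> (1 + 2 * K) * r"
      using r K_pos by (simp_all add: distrib_right)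
    ultimately have "D \<le> (1 + 2 * K) * r"
      unfolding D_def f g mho_strip[OF \<xi> x] mho_strip[OF \<eta> y] d_circle_def
        prod.case max.bounded_iff by linarith
    thus "D / (1 + 2 * K) \<le> max \<bar>\<xi> - (\<eta> + real_of_int j)\<bar> (sdist s x (shift p y j))"
      unfolding r_def using K_pos by (simp add: pos_divide_le_eq mult.commute)
  qed simp
  thus "d_circle (mho p m s f) (mho p m s g) \<le> (1 + 2 * K) * rho p \<alpha> f g"
    unfolding D_def using K_pos by (simp add: pos_divide_le_eq mult.commute)
qed (use K_pos in auto)

lemma mho_isometry:
  assumes \<Delta>: "Delta_tilde p m s > 0"
  shows "L_isometry (solenoid p) (rho p \<alpha>) (sphere 0 1 \<times> UNIV) d_circle (mho p m s)"
  unfolding L_isometry_def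
proof (intro conjI exI[of _ "1 + (1 + K) / Delta_tilde p m s"] ballI mho_contraction)
  fix f g assume fg: "f \<in> solenoid p" "g \<in> solenoid p"
  obtain \<xi> x where \<xi>: "\<xi> \<in> {-1<..0}" and x: "x \<in> Z" and f: "f = phi p (\<xi>, x)"
    using fg(1) by (rule solenoid_strip)
  obtain \<eta> y where \<eta>: "\<eta> \<in> {-1<..0}" and y: "y \<in> Z" and g: "g = phi p (\<eta>, y)"
    using fg(2) by (rule solenoid_strip)
  define D where "D = d_circle (mho p m s f) (mho p m s g)"
  obtain j where j: "circle_dist (cis (2 * pi * \<xi>)) (cis (2 * pi * \<eta>)) = \<bar>\<xi> - (\<eta> + real_of_int j)\<bar>"
      "\<bar>\<xi> - (\<eta> + real_of_int j)\<bar> \<le> 1 / 2"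
    by (rule circle_dist_attained)
  have "\<bar>real_of_int j\<bar> < 2" using j(2) \<xi> \<eta> unfolding greaterThanAtMost_iff by linarith
  hence j1: "\<bar>j\<bar> \<le> 1" by linarith
  have D: "0 \<le> D" "\<bar>\<xi> - (\<eta> + real_of_int j)\<bar> \<le> D" "cmod (omega p m s \<xi> x - omega p m s \<eta> y) \<le> D"
    by (auto simp: D_def f g mho_strip[OF \<xi> x] mho_strip[OF \<eta> y] d_circle_def j(1) le_max_iff_disj)
  have "K * \<bar>\<xi> - (\<eta> + real_of_int j)\<bar> \<le> K * D" using D K_pos by simp
  hence "Delta_tilde p m s * sdist s x (shift p y j) \<le> (1 + K) * D"
    using omega_strip_expansive[OF x y \<xi> \<eta> j1] D unfolding distrib_right by linarith
  hence "sdist s x (shift p y j) \<le> (1 + K) / Delta_tilde p m s * D"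
    using \<Delta> by (simp add: field_simps)
  moreover have "0 \<le> (1 + K) / Delta_tilde p m s * D" using D K_pos \<Delta> by simp
  ultimately have "max \<bar>\<xi> - (\<eta> + real_of_int j)\<bar> (sdist s x (shift p y j)) \<le>
      (1 + (1 + K) / Delta_tilde p m s) * D"
    using D by (simp add: distrib_right)
  moreover have "rho p \<alpha> f g \<le> max \<bar>\<xi> - (\<eta> + real_of_int j)\<bar> (sdist s x (shift p y j))"
    unfolding f g rho_phi[OF x y]
    by (rule cINF_lower) (auto intro!: bdd_belowI[of _ 0] simp: le_max_iff_disj)
  ultimately show "rho p \<alpha> f g \<le>
      (1 + (1 + K) / Delta_tilde p m s) * d_circle (mho p m s f) (mho p m s g)"
    unfolding D_def by linarith
qed (use K_pos \<Delta> in \<open>auto intro: add_pos_pos divide_pos_pos\<close>)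

lemma Omega_contraction:
  assumes "a \<noteq> 0"
  shows "L_contraction (solenoid p) (rho p \<alpha>) UNIV dist (Omega p m s a)"
  unfolding Omega_def
  by (rule L_contraction_compose[OF mho_contraction mho_range sigma_contraction[OF assms]])
    (use s_lt_1 in simp)

text \<open>
  The infimum that defines \<open>gamma_const\<close> is over a set of reals that is bounded below, because \<open>\<omega>\<close> is bounded.
\<close>

lemma gamma_const_le:
  assumes "a \<noteq> 0" "x \<in> Z"
  shows "- gamma_const p m s a \<le> Re (omega p m s \<xi> x / a)"
proof -
  have low: "- (1 / (1 - cmod s) / cmod a) \<le> Re (omega p m s \<eta> y / a)" for \<eta> y
  proof -
    have "\<bar>Re (omega p m s \<eta> y / a)\<bar> \<le> cmod (omega p m s \<eta> y) / cmod a"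
      using abs_Re_le_cmod[of "omega p m s \<eta> y / a"] by (simp add: norm_divide)
    also have "\<dots> \<le> 1 / (1 - cmod s) / cmod a"
      by (intro divide_right_mono norm_omega) simp
    finally show ?thesis by linarith
  qed
  show ?thesis
    unfolding gamma_const_def minus_minus
    by (rule cINF_lower2[of _ _ "(\<xi>, x)"]) (use assms(2) low in \<open>auto intro!: bdd_belowI\<close>)
qed

lemma Omega_isometry:
  assumes "a \<noteq> 0" "Delta_tilde p m s > 0" and \<gamma>: "gamma_const p m s a < 1"
  shows "L_isometry (solenoid p) (rho p \<alpha>) UNIV dist (Omega p m s a)"
  unfolding Omega_def
proof (rule L_isometry_compose[OF mho_isometry[OF assms(2)] mho_range sigma_contraction[OF assms(1)]])
  define \<delta> where "\<delta> = 1 - gamma_const p m s a"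
  have \<delta>: "0 < \<delta>" using \<gamma> by (simp add: \<delta>_def)
  thus "0 < 2 + 1 / (cmod a * \<delta>)" using assms(1) by (intro add_pos_pos) auto
  fix f g assume fg: "f \<in> solenoid p" "g \<in> solenoid p"
  have away: "fst (mho p m s h) \<in> sphere 0 1 \<and> \<delta> \<le> 1 + Re (snd (mho p m s h) / a)"
    if h: "h \<in> solenoid p" for h
  proof -
    obtain \<xi> x where "\<xi> \<in> {-1<..0}" and x: "x \<in> Z" and "h = phi p (\<xi>, x)"
      using h by (rule solenoid_strip)
    thus ?thesis using gamma_const_le[OF assms(1) x, of \<xi>] by (simp add: mho_strip \<delta>_def)
  qed
  show "d_circle (mho p m s f) (mho p m s g) \<le>
      (2 + 1 / (cmod a * \<delta>)) * dist (sigma a (mho p m s f)) (sigma a (mho p m s g))"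
    using sigma_expansive[OF assms(1) \<delta>, of "fst (mho p m s f)" "fst (mho p m s g)"
        "snd (mho p m s f)" "snd (mho p m s g)"] away[OF fg(1)] away[OF fg(2)] by simp
qed (use s_lt_1 in simp)

end

theorem theorem8:
  fixes p :: nat and m :: enat and s a :: complex and \<alpha> :: real
  assumes "prime p"
    and "0 < cmod s" and "cmod s < 1"
    and "a \<noteq> 0"
    and "\<alpha> = 1 / D_exponent p s"
  shows "(L_contraction (UNIV \<times> carrier (padic_int p)) (rho_hat p \<alpha>) UNIV d_hat (otimes_omega p m s) \<and>
          L_contraction (solenoid p) (rho p \<alpha>) (sphere 0 1 \<times> UNIV) d_circle (mho p m s) \<and>
          L_contraction (solenoid p) (rho p \<alpha>) UNIV dist (Omega p m s a)) \<and>
         (Delta_tilde p m s > 0 \<longrightarrow>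
          L_isometry (UNIV \<times> carrier (padic_int p)) (rho_hat p \<alpha>) UNIV d_hat (otimes_omega p m s) \<and>
          L_isometry (solenoid p) (rho p \<alpha>) (sphere 0 1 \<times> UNIV) d_circle (mho p m s) \<and>
          (gamma_const p m s a < 1 \<longrightarrow>
           L_isometry (solenoid p) (rho p \<alpha>) UNIV dist (Omega p m s a)))"
proof -
  interpret digit_series p m s
    using assms(1-3) prime_gt_1_nat[of p] by unfold_locales auto
  show ?thesis
    unfolding assms(5)
    using assms(4) otimes_omega_contraction mho_contraction Omega_contraction
      otimes_omega_isometry mho_isometry Omega_isometry by blast
qed

end
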